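(* Let $R$ be a pairing relation on $E=\{e_1,-e_1,e_2,-e_2,e_3,-e_3\}$. Then $\widehat{\mathcal{C}}_R$ satisfies the local isomorphism property if and only if $R$ satisfies (P).
   Context: Curves. Let $(e_1,e_2,e_3)$ be the canonical basis of $\mathbb{R}^3$. A segment is a non-oriented interval $[x,x+e_i]$ with $x\in\mathbb{Z}^3$. A curve is a nonoriented sequence of segments, finite or indexed by $\mathbb{N}$ or by $\mathbb{Z}$, such that (i) two consecutive segments have one and only one common endpoint, and (ii) the common endpoints of a segment with the preceding one and with the following one, when these exist, are different. Two consecutive segments of a curve are said to be connected at their common endpoint (a connexion). A curve is self-avoiding if each of its segments appears only once; curves are disjoint if they have no common segment. A set of self-avoiding curves is a covering of $\mathbb{R}^3$ if each segment appears in one and only one of its curves. The covering $\mathcal{C}$. Write $\overline{m}=-m$. Let $\mathcal{B}_0$ be the set of the $6$ curves with successive vertices $((0,0,0),(0,\overline{1},0),(0,\overline{1},\overline{1}),(0,0,\overline{1}),(1,0,\overline{1}),(1,\overline{1},\overline{1}),(1,\overline{1},0),(1,0,0),(2,0,0))$, $((0,0,0),(0,0,1),(0,1,1),(0,1,0),(\overline{1},1,0),(\overline{1},1,1),(\overline{1},0,1),(\overline{1},0,0),(\overline{2},0,0))$, $((0,0,0),(0,0,\overline{1}),(\overline{1},0,\overline{1}),(\overline{1},0,0),(\overline{1},1,0),(\overline{1},1,\overline{1}),(0,1,\overline{1}),(0,1,0),(0,2,0))$, $((0,0,0),(1,0,0),(1,0,1),(0,0,1),(0,\overline{1},1),(1,\overline{1},1),(1,\overline{1},0),(0,\overline{1},0),(0,\overline{2},0))$,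 $((0,0,0),(\overline{1},0,0),(\overline{1},\overline{1},0),(0,\overline{1},0),(0,\overline{1},1),(\overline{1},\overline{1},1),(\overline{1},0,1),(0,0,1),(0,0,2))$, $((0,0,0),(0,1,0),(1,1,0),(1,0,0),(1,0,\overline{1}),(1,1,\overline{1}),(0,1,\overline{1}),(0,0,\overline{1}),(0,0,\overline{2}))$. Let $\mathcal{B}_1,\mathcal{B}_2,\mathcal{B}_3$ be the images of $\mathcal{B}_0$ by the isometries $(a,b,c)\mapsto(2+a,2-b,-c)$, $(a,b,c)\mapsto(2-a,-b,2+c)$, $(a,b,c)\mapsto(-a,2+b,2-c)$ respectively. $\mathcal{C}$ is the set of all translates $4u+D$ with $u\in\mathbb{Z}^3$ and $D\in\mathcal{B}_0\cup\mathcal{B}_1\cup\mathcal{B}_2\cup\mathcal{B}_3$. It is a covering of $\mathbb{R}^3$, invariant under translations by $4\mathbb{Z}^3$; each of its curves joins two points $2x,2x+2e_i$ ($x\in\mathbb{Z}^3$), and any two such points are joined by a unique curve of $\mathcal{C}$. Powers and limit. For a set $\mathcal{D}$ of disjoint self-avoiding curves, $\mathcal{C}\ast\mathcal{D}$ is obtained by applying to $\mathcal{D}$ the homothety of center $0$ and ratio $2$, then replacing each resulting interval by the curve of $\mathcal{C}$ with the same endpoints. $\mathcal{C}^0$ is the set of all one-segment curves and $\mathcal{C}^{s+1}=\mathcal{C}\ast\mathcal{C}^s$; each connexion of $\mathcal{C}^s$ is also a connexion of $\mathcal{C}^{s+1}$. $\widehat{\mathcal{C}}$ is the inductive limit of the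 $\mathcal{C}^s$ (two segments are connected in $\widehat{\mathcal{C}}$ iff they are connected in some $\mathcal{C}^s$); its connexions are defined at every point of $\mathbb{Z}^3$ except $0$. A pairing relation on $E$ partitions $E$ into pairs of distinct related elements; $\widehat{\mathcal{C}}_R$ is the set of curves without endpoints obtained from $\widehat{\mathcal{C}}$ by connecting $[0,u]$ and $[0,v]$ iff $R(u,v)$. Property (P). For $x\in\mathbb{Z}^3-\{0\}$ and $u,v\in E$, write $R_x(u,v)$ if the segments $[x,x+u]$ and $[x,x+v]$ are connected in $\widehat{\mathcal{C}}$. Let $\theta$ be the permutation of $E$ with $\theta(e_1)=-e_2$, $\theta(e_2)=-e_3$, $\theta(e_3)=-e_1$, $\theta^2=\mathrm{Id}$. For a relation $R$ on $E$, $R^\theta(u,v)$ holds iff $R(\theta(u),\theta(v))$. A pairing relation $R$ satisfies (P) if there exists $x\in\{-2,0,2,4\}^3-\{0,4\}^3$ such that $R_x=R$ or $R_x=R^\theta$. Local isomorphism property. For $x\in\mathbb{Z}^3$, $h\in\mathbb{N}^{\ast}$, $\mathrm{P}_{x,h}=\{y\in\mathbb{R}^3: |y_i-x_i|\le h,\ i=1,2,3\}$, and $\mathcal{E}\upharpoonright\mathrm{P}_{x,h}$ denotes the segments of $\mathcal{E}$ contained in $\mathrm{P}_{x,h}$ with the connexions of $\mathcal{E}$ between them; $\cong$ means equality up to translation. $\mathcal{E}$ satisfies the local isomorphism property if for each $x\in\mathbb{Z}^3$ and $h\in\mathbb{N}^{\ast}$ there exists $t\in\mathbb{R}^{+}$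 such that each Euclidean ball of radius $t$ contains some $z\in\mathbb{Z}^3$ with $\mathcal{E}\upharpoonright\mathrm{P}_{z,h}\cong\mathcal{E}\upharpoonright\mathrm{P}_{x,h}$. *)

theory Defs
  imports "HOL-Analysis.Analysis"
begin

type_synonym point = "int ^ 3"

text \<open>A segment \<open>[x, x + e\<^sub>i]\<close> is encoded by the set of its two endpoints;
  \<open>interval_of\<close> is the actual subset of \<open>\<real>\<^sup>3\<close>.\<close>

type_synonym seg = "point set"

definition real_point :: "point \<Rightarrow> real ^ 3" where
  "real_point x = (\<chi> i. real_of_int (x $ i))"

definition segments :: "seg set" where
  "segments = {{x, x + axis i 1} | (x :: point) (i :: 3). True}"

definition interval_of :: "seg \<Rightarrow> (real ^ 3) set" where
  "interval_of s = convex hull (real_point ` s)"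


section \<open>Curves\<close>

text \<open>A curve, finite or indexed by \<open>\<nat>\<close> or \<open>\<int>\<close>, is given by its successive vertices
  \<open>v\<^sub>k\<close>; its \<open>k\<close>-th segment is \<open>{v\<^sub>k, v\<^bsub>k+1\<^esub>}\<close>. Two consecutive segments
  \<open>{a, b}\<close>, \<open>{b, d}\<close> have exactly one common endpoint iff \<open>a \<noteq> d\<close>, and since
  \<open>v\<^sub>k \<noteq> v\<^bsub>k+1\<^esub>\<close> the common endpoints with the preceding and the following segment are
  then automatically different.
  Curves are nonoriented: a value of type \<open>curve\<close> is a parametrization of a curve, and a
  set of curves may contain several parametrizations of the same curve. Everything below
  depends only on segments and on the symmetric relation \<open>connected\<close>, hence not on the
  choice of parametrizations.\<close>

datatype curve =
    Fin_curve "point list"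
  | Nat_curve "nat \<Rightarrow> point"
  | Int_curve "int \<Rightarrow> point"

fun steps :: "curve \<Rightarrow> (point \<times> point) set" where
  "steps (Fin_curve xs) = {(xs ! k, xs ! (k + 1)) | k. k + 1 < length xs}"
| "steps (Nat_curve f) = {(f k, f (k + 1)) | k. True}"
| "steps (Int_curve f) = {(f k, f (k + 1)) | k. True}"

fun corners :: "curve \<Rightarrow> (point \<times> point \<times> point) set" where
  "corners (Fin_curve xs) = {(xs ! k, xs ! (k + 1), xs ! (k + 2)) | k. k + 2 < length xs}"
| "corners (Nat_curve f) = {(f k, f (k + 1), f (k + 2)) | k. True}"
| "corners (Int_curve f) = {(f k, f (k + 1), f (k + 2)) | k. True}"

definition is_curve :: "curve \<Rightarrow> bool" where
  "is_curve c \<longleftrightarrow> steps c \<noteq> {} \<and> (\<forall>(a, b) \<in> steps c. {a, b} \<in> segments)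
     \<and> (\<forall>(a, b, d) \<in> corners c. a \<noteq> d)"

definition segments_of :: "curve set \<Rightarrow> seg set" where
  "segments_of \<E> = {{a, b} | a b. \<exists>c \<in> \<E>. (a, b) \<in> steps c}"

text \<open>Two consecutive segments have a single common endpoint, so a connexion is determined
  by the pair of segments.\<close>

definition connected :: "curve set \<Rightarrow> seg \<Rightarrow> seg \<Rightarrow> bool" where
  "connected \<E> s t \<longleftrightarrow> (\<exists>c \<in> \<E>. \<exists>(a, b, d) \<in> corners c.
     s = {a, b} \<and> t = {b, d} \<or> s = {b, d} \<and> t = {a, b})"


section \<open>The covering \<open>\<C>\<close>\<close>

definition \<B>\<^sub>0 :: "point list set" where
  "\<B>\<^sub>0 = map vector ` {
     [[0,0,0],[0,-1,0],[0,-1,-1],[0,0,-1],[1,0,-1],[1,-1,-1],[1,-1,0],[1,0,0],[2,0,0]],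
     [[0,0,0],[0,0,1],[0,1,1],[0,1,0],[-1,1,0],[-1,1,1],[-1,0,1],[-1,0,0],[-2,0,0]],
     [[0,0,0],[0,0,-1],[-1,0,-1],[-1,0,0],[-1,1,0],[-1,1,-1],[0,1,-1],[0,1,0],[0,2,0]],
     [[0,0,0],[1,0,0],[1,0,1],[0,0,1],[0,-1,1],[1,-1,1],[1,-1,0],[0,-1,0],[0,-2,0]],
     [[0,0,0],[-1,0,0],[-1,-1,0],[0,-1,0],[0,-1,1],[-1,-1,1],[-1,0,1],[0,0,1],[0,0,2]],
     [[0,0,0],[0,1,0],[1,1,0],[1,0,0],[1,0,-1],[1,1,-1],[0,1,-1],[0,0,-1],[0,0,-2]]}"

definition \<B>\<^sub>1 :: "point list set" where
  "\<B>\<^sub>1 = map (\<lambda>p. vector [2 + p $ 1, 2 - p $ 2, - (p $ 3)]) ` \<B>\<^sub>0"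

definition \<B>\<^sub>2 :: "point list set" where
  "\<B>\<^sub>2 = map (\<lambda>p. vector [2 - p $ 1, - (p $ 2), 2 + p $ 3]) ` \<B>\<^sub>0"

definition \<B>\<^sub>3 :: "point list set" where
  "\<B>\<^sub>3 = map (\<lambda>p. vector [- (p $ 1), 2 + p $ 2, 2 - p $ 3]) ` \<B>\<^sub>0"

definition \<C> :: "point list set" where
  "\<C> = {map (\<lambda>p. 4 *s u + p) D | u D. D \<in> \<B>\<^sub>0 \<union> \<B>\<^sub>1 \<union> \<B>\<^sub>2 \<union> \<B>\<^sub>3}"

text \<open>The unique curve of \<open>\<C>\<close> joining \<open>a\<close> and \<open>b\<close>, listed from \<open>a\<close> to \<open>b\<close>
  (meaningful for \<open>{a, b} = {2x, 2x + 2e\<^sub>i}\<close>).\<close>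

definition \<C>_path :: "point \<Rightarrow> point \<Rightarrow> point list" where
  "\<C>_path a b = (THE xs. (xs \<in> \<C> \<or> rev xs \<in> \<C>) \<and> hd xs = a \<and> last xs = b)"


section \<open>Powers and limit\<close>

fun refine :: "point list \<Rightarrow> point list" where
  "refine [] = []"
| "refine [x] = [2 *s x]"
| "refine (x # y # zs) = butlast (\<C>_path (2 *s x) (2 *s y)) @ refine (y # zs)"

text \<open>The operation \<open>\<D> \<mapsto> \<C> \<ast> \<D>\<close>, on sets of finite curves; the curves of every
  \<open>\<C>\<^sup>s\<close> are finite.\<close>

definition star :: "curve set \<Rightarrow> curve set" where
  "star \<D> = {Fin_curve (refine xs) | xs. Fin_curve xs \<in> \<D>}"

fun \<C>_power :: "nat \<Rightarrow> curve set" where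
  "\<C>_power 0 = {Fin_curve [x, y] | x y. {x, y} \<in> segments}"
| "\<C>_power (Suc s) = star (\<C>_power s)"

definition limit_connected :: "seg \<Rightarrow> seg \<Rightarrow> bool" where
  "limit_connected s t \<longleftrightarrow> (\<exists>n. connected (\<C>_power n) s t)"

definition E :: "point set" where
  "E = {axis 1 1, - axis 1 1, axis 2 1, - axis 2 1, axis 3 1, - axis 3 1}"

definition pairing_relation :: "'a set \<Rightarrow> ('a \<Rightarrow> 'a \<Rightarrow> bool) \<Rightarrow> bool" where
  "pairing_relation A R \<longleftrightarrow>
     (\<exists>\<P>. partition_on A \<P> \<and> (\<forall>p \<in> \<P>. card p = 2) \<and> (\<forall>u v. R u v \<longleftrightarrow> u \<noteq> v \<and> {u, v} \<in> \<P>))"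

text \<open>The connexions of the inductive limit \<open>\<C>^\<close>, completed by those of \<open>R\<close> at \<open>0\<close>.
  Curves without endpoints are those indexed by \<open>\<int>\<close>.\<close>

definition joined :: "(point \<Rightarrow> point \<Rightarrow> bool) \<Rightarrow> seg \<Rightarrow> seg \<Rightarrow> bool" where
  "joined R s t \<longleftrightarrow> limit_connected s t \<or> (\<exists>u v. R u v \<and> s = {0, u} \<and> t = {0, v})"

definition \<C>_hat :: "(point \<Rightarrow> point \<Rightarrow> bool) \<Rightarrow> curve set" where
  "\<C>_hat R = {c. is_curve c \<and> (\<exists>f. c = Int_curve f)
     \<and> (\<forall>(a, b, d) \<in> corners c. joined R {a, b} {b, d})}"


section \<open>Property (P)\<close>

definition R_at :: "point \<Rightarrow> point \<Rightarrow> point \<Rightarrow> bool" where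
  "R_at x u v \<longleftrightarrow> u \<in> E \<and> v \<in> E \<and> limit_connected {x, x + u} {x, x + v}"

text \<open>\<open>\<theta>\<close> is an involution of \<open>E\<close>, not the restriction of a linear map: for
  instance \<open>\<theta> e\<^sub>1 = - e\<^sub>2\<close> but \<open>\<theta> (- e\<^sub>1) = e\<^sub>3\<close>. Outside \<open>E\<close> it is the identity.\<close>

definition \<theta> :: "point \<Rightarrow> point" where
  "\<theta> u =
    (if u = axis 1 1 then - axis 2 1 else if u = - axis 2 1 then axis 1 1
     else if u = axis 2 1 then - axis 3 1 else if u = - axis 3 1 then axis 2 1
     else if u = axis 3 1 then - axis 1 1 else if u = - axis 1 1 then axis 3 1
     else u)"

definition property_P :: "(point \<Rightarrow> point \<Rightarrow> bool) \<Rightarrow> bool" where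
  "property_P R \<longleftrightarrow>
     (\<exists>x. (\<forall>i. x $ i \<in> {-2, 0, 2, 4}) \<and> \<not> (\<forall>i. x $ i \<in> {0, 4})
        \<and> (R_at x = R \<or> R_at x = (\<lambda>u v. R (\<theta> u) (\<theta> v))))"


section \<open>Local isomorphism property\<close>

definition box :: "point \<Rightarrow> nat \<Rightarrow> (real ^ 3) set" where
  "box x h = {y. \<forall>i. \<bar>y $ i - real_of_int (x $ i)\<bar> \<le> real h}"

text \<open>The restriction of \<open>\<E>\<close> to \<open>P\<close>: the segments contained in \<open>P\<close>, and the
  connexions between them.\<close>

definition restriction :: "curve set \<Rightarrow> (real ^ 3) set \<Rightarrow> seg set \<times> (seg \<times> seg) set" where
  "restriction \<E> P =
     (let S = {s \<in> segments_of \<E>. interval_of s \<subseteq> P}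
      in (S, {(s, t). s \<in> S \<and> t \<in> S \<and> connected \<E> s t}))"

definition translate :: "point \<Rightarrow> seg set \<times> (seg \<times> seg) set \<Rightarrow> seg set \<times> (seg \<times> seg) set" where
  "translate w = map_prod ((`) ((`) ((+) w))) ((`) (map_prod ((`) ((+) w)) ((`) ((+) w))))"

definition local_isomorphism_property :: "curve set \<Rightarrow> bool" where
  "local_isomorphism_property \<E> \<longleftrightarrow>
     (\<forall>x. \<forall>h \<ge> 1. \<exists>t > 0. \<forall>q :: real ^ 3. \<exists>z. real_point z \<in> cball q t
        \<and> (\<exists>w. restriction \<E> (box z h) = translate w (restriction \<E> (box x h))))"

end

theory Submission
  imports Defs
begin

text \<open>The connexions of the limit at a point with an odd coordinate are those of \<open>\<C>\<close>, hence depend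
  only on the point modulo 4. Those at \<open>2c\<close> are the images of those at \<open>c\<close> under the map \<open>\<phi> c\<close> that
  sends \<open>u\<close> to the first direction of the curve of \<open>\<C>\<close> from \<open>2c\<close> to \<open>2c + 2u\<close>; this map depends only
  on \<open>c\<close> modulo 2 and is \<open>\<theta>\<close> for even \<open>c\<close>. So the connexions at \<open>2\<^sup>k y\<close>, \<open>y\<close> not even, depend only on
  \<open>y\<close> modulo 4 and, for \<open>k \<ge> 1\<close>, on the parity of \<open>k\<close>, and (P) says that \<open>R\<close> occurs at some nonzero
  even point, equivalently at points \<open>2\<^sup>k y\<close> with \<open>k\<close> arbitrarily large. Around \<open>2\<^sup>k (4m + y)\<close> the
  covering looks up to distance about \<open>2\<^sup>k\<^sup>-\<^sup>1\<close> as it does around 0, which gives the local isomorphism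
  property. Conversely, a copy of a neighbourhood of 0 around some \<open>z \<noteq> 0\<close> exhibits \<open>R\<close> at \<open>z\<close>, and
  \<open>z\<close> must be even, because the connexions of \<open>\<C>\<close> near 0 distinguish 0 from the points modulo 4 with
  an odd coordinate.\<close>

section \<open>Finite computations on integer triples\<close>

type_synonym triple = "int \<times> int \<times> int"

definition base0 :: "triple list list" where
  "base0 = [
     [(0,0,0),(0,-1,0),(0,-1,-1),(0,0,-1),(1,0,-1),(1,-1,-1),(1,-1,0),(1,0,0),(2,0,0)],
     [(0,0,0),(0,0,1),(0,1,1),(0,1,0),(-1,1,0),(-1,1,1),(-1,0,1),(-1,0,0),(-2,0,0)],
     [(0,0,0),(0,0,-1),(-1,0,-1),(-1,0,0),(-1,1,0),(-1,1,-1),(0,1,-1),(0,1,0),(0,2,0)],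
     [(0,0,0),(1,0,0),(1,0,1),(0,0,1),(0,-1,1),(1,-1,1),(1,-1,0),(0,-1,0),(0,-2,0)],
     [(0,0,0),(-1,0,0),(-1,-1,0),(0,-1,0),(0,-1,1),(-1,-1,1),(-1,0,1),(0,0,1),(0,0,2)],
     [(0,0,0),(0,1,0),(1,1,0),(1,0,0),(1,0,-1),(1,1,-1),(0,1,-1),(0,0,-1),(0,0,-2)]]"

definition base :: "triple list list" where
  "base = base0
     @ map (map (\<lambda>(a, b, c). (2 + a, 2 - b, - c))) base0
     @ map (map (\<lambda>(a, b, c). (2 - a, - b, 2 + c))) base0
     @ map (map (\<lambda>(a, b, c). (- a, 2 + b, 2 - c))) base0"

text \<open>Both orientations are listed, so that every path can be looked up by its starting
  point.\<close>

definition paths :: "triple list list" where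
  "paths = base @ map rev base"

definition dirs :: "triple list" where
  "dirs = [(1,0,0), (-1,0,0), (0,1,0), (0,-1,0), (0,0,1), (0,0,-1)]"

fun add3 :: "triple \<Rightarrow> triple \<Rightarrow> triple" where
  "add3 (a, b, c) (a', b', c') = (a + a', b + b', c + c')"

fun diff3 :: "triple \<Rightarrow> triple \<Rightarrow> triple" where
  "diff3 (a, b, c) (a', b', c') = (a - a', b - b', c - c')"

fun mod4 :: "triple \<Rightarrow> triple" where
  "mod4 (a, b, c) = (a mod 4, b mod 4, c mod 4)"

fun even3 :: "triple \<Rightarrow> bool" where
  "even3 (a, b, c) \<longleftrightarrow> even a \<and> even b \<and> even c"

fun twice :: "triple \<Rightarrow> triple" where
  "twice (a, b, c) = (2 * a, 2 * b, 2 * c)"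

text \<open>Identifies an oriented path up to translation by \<open>4\<int>\<^sup>3\<close>.\<close>

definition path_key :: "triple list \<Rightarrow> triple \<times> triple" where
  "path_key D = (mod4 (hd D), diff3 (last D) (hd D))"

definition cube :: "int list \<Rightarrow> triple list" where
  "cube xs = List.product xs (List.product xs xs)"


text \<open>A turn records a corner of a path by the class of its vertex modulo 4 and the directions towards
  the two neighbours.\<close>

fun turns :: "triple list \<Rightarrow> (triple \<times> triple \<times> triple) list" where
  "turns (a # b # d # xs) = (mod4 b, diff3 a b, diff3 d b) # turns (b # d # xs)"
| "turns _ = []"

definition turn_list :: "(triple \<times> triple \<times> triple) list" where
  "turn_list = concat (map turns paths)"

fun increments :: "triple list \<Rightarrow> triple list" where
  "increments (a # b # xs) = (diff3 b a) # increments (b # xs)"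
| "increments _ = []"

text \<open>The finite checks are phrased with named predicates rather than abstractions, as \<open>code_simp\<close>
  would otherwise unfold their bodies on symbolic arguments.\<close>

definition good_path :: "triple list \<Rightarrow> bool" where
  "good_path D \<longleftrightarrow> length D = 9 \<and> even3 (hd D) \<and> List.member (map twice dirs) (diff3 (last D) (hd D)) \<and>
       list_all (List.member dirs) (increments D) \<and> list_all (Not \<circ> even3) (butlast (tl D))"

lemma good_paths: "list_all good_path paths"
  by code_simp

text \<open>This yields the uniqueness needed for the definite description in
  \<open>\<C>_path\<close>.\<close>

lemma distinct_path_keys: "distinct (map path_key paths)"
  by code_simp

definition key_for :: "(triple \<times> triple) list \<Rightarrow> triple \<times> triple \<Rightarrow> bool" where
  "key_for ks x = List.member ks (twice (fst x), twice (snd x))"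

text \<open>Existence of a path from \<open>2c\<close> to \<open>2c + 2u\<close>: eight parity
  classes of \<open>c\<close> and six directions \<open>u\<close> suffice, since \<open>2c\<close>
  modulo 4 depends only on \<open>c\<close> modulo 2.\<close>

lemma path_keys_complete: "list_all (key_for (map path_key paths)) (List.product (cube [0, 1]) dirs)"
  by code_simp


definition turning :: "triple \<Rightarrow> triple \<Rightarrow> triple \<Rightarrow> bool" where
  "turning p u v \<longleftrightarrow> (p, u, v) \<in> set turn_list"

lemma turning_all: "list_all (\<lambda>(p, u, v). turning p u v) turn_list"
  by (auto simp: list_all_iff turning_def)

text \<open>Unfolds into one ground fact per turn. Used as rewrite rules, these settle the
  existential statements below.\<close>

lemmas turnings = turning_all[unfolded turn_list_def paths_def base_def base0_def, simplified]

definition total_at :: "triple \<Rightarrow> bool" where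
  "total_at p \<longleftrightarrow> even3 p \<or> (\<forall>u\<in>set dirs. \<exists>v\<in>set dirs. u \<noteq> v \<and> turning p u v)"

text \<open>One half of the pairing property of \<C> at points that are not even; the other half,
  uniqueness, is obtained later by counting.\<close>

lemma turning_total: "list_all total_at (cube [0, 1, 2, 3])"
  by (simp add: cube_def, simp add: total_at_def dirs_def turnings)

text \<open>The three turns were found by a computer search.\<close>

definition shift_detected :: "triple \<Rightarrow> bool" where
  "shift_detected z \<longleftrightarrow> even3 z \<or> (\<exists>(b, u, v) \<in>
     {((-1,-1,-1), (-1,0,0), (0,0,1)), ((-1,0,0), (0,0,1), (-1,0,0)), ((0,1,-1), (-1,0,0), (0,0,1))}.
     turning (mod4 b) u v \<and> (\<exists>w\<in>set dirs. w \<noteq> v \<and> turning (mod4 (add3 b z)) u w))"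

lemma shift_detected: "list_all shift_detected (cube [0, 1, 2, 3])"
  by (simp add: cube_def, simp add: shift_detected_def dirs_def turnings)


lemma turning_swap_all: "list_all (\<lambda>(p, u, v). turning p v u) turn_list"
  by (simp add: turn_list_def paths_def base_def base0_def turnings)

text \<open>48 oriented paths with 7 inner vertices each; also 64 - 8 = 56 classes modulo 4 that are
  not even, times 6 directions.\<close>

lemma length_turn_list: "length turn_list = 336"
  by code_simp

definition first_key :: "triple list \<Rightarrow> triple \<times> triple" where
  "first_key D = (mod4 (hd D), diff3 (D ! 1) (hd D))"

text \<open>Source of the injectivity of \<open>\<phi>\<close>: no two paths leave the same class of
  points in the same direction.\<close>

lemma distinct_first_keys: "distinct (map first_key paths)"
  by code_simp

fun theta3 :: "triple \<Rightarrow> triple" where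
  "theta3 (a, b, c) =
    (if (a, b, c) = (1, 0, 0) then (0, -1, 0) else if (a, b, c) = (0, -1, 0) then (1, 0, 0)
     else if (a, b, c) = (0, 1, 0) then (0, 0, -1) else if (a, b, c) = (0, 0, -1) then (0, 1, 0)
     else if (a, b, c) = (0, 0, 1) then (-1, 0, 0) else if (a, b, c) = (-1, 0, 0) then (0, 0, 1)
     else (a, b, c))"

definition starts_with_theta :: "triple list \<Rightarrow> bool" where
  "starts_with_theta D \<longleftrightarrow> (mod4 (hd D) = (0, 0, 0) \<longrightarrow> diff3 (last D) (hd D) = twice (theta3 (diff3 (D ! 1) (hd D))))"

text \<open>The origin of \<theta>: it exchanges the first direction and the overall direction of
  the paths that start at multiples of 4.\<close>

lemma starts_with_theta: "list_all starts_with_theta paths"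
  by code_simp

section \<open>Transfer between triples and points\<close>

definition pt :: "triple \<Rightarrow> point" where
  "pt = (\<lambda>(a, b, c). vector [a, b, c])"

definition coords :: "point \<Rightarrow> triple" where
  "coords p = (p $ 1, p $ 2, p $ 3)"

lemma pt_nth [simp]: "pt (a, b, c) $ 1 = a" "pt (a, b, c) $ 2 = b" "pt (a, b, c) $ 3 = c"
  by (simp_all add: pt_def)

lemma pt_coords [simp]: "pt (coords p) = p"
  by (simp add: vec_eq_iff forall_3 coords_def)

lemma coords_pt [simp]: "coords (pt t) = t"
  by (cases t) (simp add: coords_def)

lemma pt_eq_iff: "pt s = pt t \<longleftrightarrow> s = t"
  by (metis coords_pt)

lemma pt_add3: "pt (add3 s t) = pt s + pt t"
  by (cases s; cases t) (simp add: vec_eq_iff forall_3)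

lemma pt_diff3: "pt (diff3 s t) = pt s - pt t"
  by (cases s; cases t) (simp add: vec_eq_iff forall_3)

lemma pt_twice: "pt (twice t) = 2 *s pt t"
  by (cases t) (simp add: vec_eq_iff forall_3)

lemma E_eq: "E = pt ` set dirs"
  by (auto simp: E_def dirs_def vec_eq_iff forall_3 axis_def image_iff)

lemma coords_E: "u \<in> E \<longleftrightarrow> coords u \<in> set dirs"
  by (metis E_eq coords_pt image_iff pt_coords)

definition evn :: "point \<Rightarrow> bool" where
  "evn p \<longleftrightarrow> (\<forall>i. even (p $ i))"

lemma even3_coords: "even3 (coords p) \<longleftrightarrow> evn p"
  by (simp add: coords_def evn_def forall_3)

lemma evn_iff: "evn p \<longleftrightarrow> (\<exists>c. p = 2 *s c)"
proof
  assume "evn p"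
  then have "p = 2 *s (\<chi> i. p $ i div 2)"
    by (simp add: evn_def vec_eq_iff)
  then show "\<exists>c. p = 2 *s c" ..
qed (auto simp: evn_def)

lemma mod4_coords_eq_iff: "mod4 (coords p) = mod4 (coords q) \<longleftrightarrow> (\<exists>m. p = 4 *s m + q)"
proof
  assume "mod4 (coords p) = mod4 (coords q)"
  then have "4 dvd p $ i - q $ i" for i
    using exhaust_3[of i] by (auto simp: coords_def mod_eq_dvd_iff)
  then have "p = 4 *s (\<chi> i. (p $ i - q $ i) div 4) + q"
    by (simp add: vec_eq_iff)
  then show "\<exists>m. p = 4 *s m + q" ..
qed (auto simp: coords_def)

lemma mod4_eq_iff: "mod4 s = mod4 t \<longleftrightarrow> (\<exists>m. pt s = 4 *s m + pt t)"
  using mod4_coords_eq_iff[of "pt s" "pt t"] by simp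

lemma mod4_shift [simp]: "mod4 (coords (4 *s m + p)) = mod4 (coords p)"
  using mod4_coords_eq_iff by blast

lemma even3_mod4 [simp]: "even3 (mod4 t) \<longleftrightarrow> even3 t"
  by (cases t) (simp add: dvd_mod_iff)

lemma mod4_mod4 [simp]: "mod4 (mod4 t) = mod4 t"
  by (cases t) simp

lemma mem_cube: "(a, b, c) \<in> set (cube xs) \<longleftrightarrow> a \<in> set xs \<and> b \<in> set xs \<and> c \<in> set xs"
  by (simp add: cube_def)

lemma mod4_in_cube: "mod4 t \<in> set (cube [0, 1, 2, 3])"
proof -
  have "a mod 4 \<in> {0, 1, 2, 3}" for a :: int
    by auto
  then show ?thesis
    by (cases t) (simp add: mem_cube del: insert_iff)
qed

lemma uminus_E: "- u \<in> E \<longleftrightarrow> u \<in> E"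
proof -
  have "v \<in> E \<Longrightarrow> - v \<in> E" for v
    by (auto simp: E_def)
  from this[of u] this[of "- u"] show ?thesis by auto
qed

lemma zero_notin_E: "0 \<notin> E"
  by (auto simp: E_def axis_eq_0_iff)

lemma finite_E: "finite E"
  by (simp add: E_def)

section \<open>Neighbouring points and segments\<close>

definition adj :: "point \<Rightarrow> point \<Rightarrow> bool" where
  "adj a b \<longleftrightarrow> b - a \<in> E"

lemma adj_sym: "adj a b \<Longrightarrow> adj b a"
  using uminus_E[of "b - a"] by (simp add: adj_def)

lemma adj_neq: "adj a b \<Longrightarrow> a \<noteq> b"
  using zero_notin_E by (auto simp: adj_def)

lemma adj_add [simp]: "adj x (x + u) \<longleftrightarrow> u \<in> E" "adj (x + u) x \<longleftrightarrow> u \<in> E"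
  by (simp_all add: adj_def uminus_E)

lemma segments_iff: "{a, b} \<in> segments \<longleftrightarrow> adj a b"
proof
  assume "{a, b} \<in> segments"
  then obtain x i where "{a, b} = {x, x + axis i 1}"
    by (auto simp: segments_def)
  moreover have "axis i 1 \<in> E"
    using exhaust_3[of i] by (auto simp: E_def)
  ultimately show "adj a b"
    by (auto simp: doubleton_eq_iff)
next
  assume "adj a b"
  then obtain i where "b - a = axis i 1 \<or> b - a = - axis i 1"
    by (auto simp: adj_def E_def)
  then have "b = a + axis i 1 \<or> a = b + axis i 1"
    by (auto simp: algebra_simps)
  then show "{a, b} \<in> segments"
    unfolding segments_def by (auto simp: insert_commute)
qed

lemma segmentE:
  assumes "s \<in> segments" obtains a b where "s = {a, b}" "adj a b"
  using assms segments_iff unfolding segments_def by blast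

lemma adj_not_evn: "adj a b \<Longrightarrow> \<not> evn a \<or> \<not> evn b"
proof (rule ccontr)
  assume "adj a b" "\<not> (\<not> evn a \<or> \<not> evn b)"
  then have "coords (b - a) \<in> set dirs" "even3 (coords (b - a))"
    by (auto simp: adj_def coords_E coords_def evn_def)
  then show False
    by (auto simp: dirs_def)
qed

section \<open>The paths of the covering\<close>

lemma good_pathD:
  assumes "D \<in> set paths"
  shows "length D = 9" "even3 (hd D)" "diff3 (last D) (hd D) \<in> twice ` set dirs"
    "set (increments D) \<subseteq> set dirs" "\<forall>p \<in> set (butlast (tl D)). \<not> even3 p"
  using good_paths assms by (auto simp: list_all_iff good_path_def)

lemma inj_on_path_key: "inj_on path_key (set paths)"
  using distinct_path_keys by (simp add: distinct_map)

lemma inj_on_first_key: "inj_on first_key (set paths)"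
  using distinct_first_keys by (simp add: distinct_map)

lemma rev_paths: "D \<in> set paths \<Longrightarrow> rev D \<in> set paths"
  by (auto simp: paths_def)

lemma \<B>\<^sub>0_eq: "\<B>\<^sub>0 = map pt ` set base0"
  by (simp add: \<B>\<^sub>0_def base0_def pt_def)

lemma \<B>_eq: "\<B>\<^sub>0 \<union> \<B>\<^sub>1 \<union> \<B>\<^sub>2 \<union> \<B>\<^sub>3 = map pt ` set base"
proof -
  have eq: "map g ` map pt ` X = map pt ` map f ` X" if "\<And>t. g (pt t) = pt (f t)" for f g X
    using that by (simp add: image_image comp_def)
  have "\<B>\<^sub>1 = map pt ` map (\<lambda>(a, b, c). (2 + a, 2 - b, - c)) ` set base0"
    unfolding \<B>\<^sub>1_def \<B>\<^sub>0_eq by (rule eq) (auto simp: pt_def)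
  moreover have "\<B>\<^sub>2 = map pt ` map (\<lambda>(a, b, c). (2 - a, - b, 2 + c)) ` set base0"
    unfolding \<B>\<^sub>2_def \<B>\<^sub>0_eq by (rule eq) (auto simp: pt_def)
  moreover have "\<B>\<^sub>3 = map pt ` map (\<lambda>(a, b, c). (- a, 2 + b, 2 - c)) ` set base0"
    unfolding \<B>\<^sub>3_def \<B>\<^sub>0_eq by (rule eq) (auto simp: pt_def)
  ultimately show ?thesis
    unfolding base_def \<B>\<^sub>0_eq by (simp add: image_Un Un_assoc)
qed

definition place :: "point \<Rightarrow> triple list \<Rightarrow> point list" where
  "place m D = map (\<lambda>t. 4 *s m + pt t) D"

lemma \<C>_eq: "\<C> = {place m D | m D. D \<in> set base}"
  unfolding \<C>_def \<B>_eq by (force simp: place_def)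

lemma \<C>_or_rev: "xs \<in> \<C> \<or> rev xs \<in> \<C> \<longleftrightarrow> (\<exists>m. \<exists>D \<in> set paths. xs = place m D)"
proof -
  have "rev xs = place m D \<longleftrightarrow> xs = place m (rev D)" for m D
    by (metis place_def rev_map rev_rev_ident)
  then have "xs \<in> \<C> \<or> rev xs \<in> \<C> \<longleftrightarrow> (\<exists>m. \<exists>D \<in> set base. xs = place m D \<or> xs = place m (rev D))"
    unfolding \<C>_eq by auto
  then show ?thesis
    by (auto simp: paths_def)
qed

lemma path_nonempty: "D \<in> set paths \<Longrightarrow> D \<noteq> []"
  using good_pathD(1) by fastforce

lemma hd_place: "D \<in> set paths \<Longrightarrow> hd (place m D) = 4 *s m + pt (hd D)"
  by (simp add: place_def hd_map path_nonempty)

lemma last_place: "D \<in> set paths \<Longrightarrow> last (place m D) = 4 *s m + pt (last D)"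
  by (simp add: place_def last_map path_nonempty)

text \<open>A competing path with the same ends has the same \<open>path_key\<close>, hence is the
  same listed path, and the common starting point then fixes the translation.\<close>

lemma \<C>_path_place:
  assumes D: "D \<in> set paths"
  shows "\<C>_path (4 *s m + pt (hd D)) (4 *s m + pt (last D)) = place m D"
  unfolding \<C>_path_def \<C>_or_rev
proof (rule the_equality)
  show "(\<exists>m'. \<exists>D'\<in>set paths. place m D = place m' D') \<and> hd (place m D) = 4 *s m + pt (hd D)
    \<and> last (place m D) = 4 *s m + pt (last D)"
    using D by (auto simp: hd_place last_place)
next
  fix xs
  assume *: "(\<exists>m'. \<exists>D'\<in>set paths. xs = place m' D') \<and> hd xs = 4 *s m + pt (hd D)
    \<and> last xs = 4 *s m + pt (last D)"
  then obtain m' D' where D': "D' \<in> set paths" "xs = place m' D'" by blast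
  have h: "4 *s m' + pt (hd D') = 4 *s m + pt (hd D)" and l: "4 *s m' + pt (last D') = 4 *s m + pt (last D)"
    using * D' by (simp_all add: hd_place last_place)
  have "pt (hd D') = 4 *s (m - m') + pt (hd D)"
    using h by (simp add: algebra_simps vector_ssub_ldistrib)
  then have "mod4 (hd D') = mod4 (hd D)"
    using mod4_eq_iff by blast
  moreover have "pt (last D') - pt (hd D') = (4 *s m' + pt (last D')) - (4 *s m' + pt (hd D'))"
    by simp
  then have "pt (diff3 (last D') (hd D')) = pt (diff3 (last D) (hd D))"
    unfolding pt_diff3 h l by simp
  ultimately have "D' = D"
    using inj_on_path_key D D'(1) by (auto simp: path_key_def pt_eq_iff inj_on_def)
  then show "xs = place m D"
    using D'(2) h by (simp add: place_def)
qed

text \<open>Reducing \<open>a\<close> modulo 2 gives a class covered by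
  \<open>path_keys_complete\<close>; the difference between \<open>2a\<close> and the start of the
  listed path is a multiple of 4 and becomes the translation.\<close>

lemma key_exists: 
  assumes "adj a b"
  obtains m D where "D \<in> set paths" "2 *s a = 4 *s m + pt (hd D)" "2 *s b = 4 *s m + pt (last D)"
    "\<C>_path (2 *s a) (2 *s b) = place m D"
proof -
  define c where "c = pt (a $ 1 mod 2, a $ 2 mod 2, a $ 3 mod 2)"
  have m: "a $ i mod 2 \<in> {0, 1}" for i
    by auto
  have "coords c \<in> set (cube [0, 1])"
    unfolding c_def coords_pt mem_cube using m by simp
  moreover have "coords (b - a) \<in> set dirs"
    using assms by (simp add: adj_def coords_E)
  ultimately have "(coords c, coords (b - a)) \<in> set (List.product (cube [0, 1]) dirs)"
    by simp
  then have "key_for (map path_key paths) (coords c, coords (b - a))"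
    using path_keys_complete unfolding list_all_iff by blast
  then have "(twice (coords c), twice (coords (b - a))) \<in> path_key ` set paths"
    by (simp add: key_for_def)
  then obtain D where D: "D \<in> set paths" "mod4 (hd D) = twice (coords c)"
    "diff3 (last D) (hd D) = twice (coords (b - a))"
    by (auto simp: path_key_def)
  have "mod4 (hd D) = mod4 (mod4 (hd D))" by simp
  also have "\<dots> = mod4 (coords (2 *s a))"
    unfolding D(2) by (simp add: c_def coords_def mod_mult_mult1[of 2 _ 2, simplified])
  finally obtain m where m: "2 *s a = 4 *s m + pt (hd D)"
    using mod4_coords_eq_iff[of "2 *s a" "pt (hd D)"] by auto
  have "pt (last D) - pt (hd D) = 2 *s (b - a)"
    by (simp flip: pt_diff3 add: D(3) pt_twice)
  then have l: "2 *s b = 4 *s m + pt (last D)"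
    using m by (simp add: algebra_simps vector_ssub_ldistrib)
  show ?thesis
    using that D(1) m l \<C>_path_place[OF D(1), of m] by simp
qed

text \<open>Converse of \<open>key_exists\<close>: a listed path starts at an even point and its
  displacement is twice a unit vector, so halving its ends gives neighbours.\<close>

lemma place_ends:
  assumes D: "D \<in> set paths"
  obtains a b where "adj a b" "2 *s a = 4 *s m + pt (hd D)" "2 *s b = 4 *s m + pt (last D)"
    "\<C>_path (2 *s a) (2 *s b) = place m D"
proof -
  obtain h where h: "pt (hd D) = 2 *s h"
    using good_pathD(2)[OF D] even3_coords[of "pt (hd D)"] evn_iff by auto
  obtain u where u: "u \<in> set dirs" "diff3 (last D) (hd D) = twice u"
    using good_pathD(3)[OF D] by auto
  have l: "pt (last D) = 2 *s (h + pt u)"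
    using pt_diff3[of "last D" "hd D"] by (simp add: u h pt_twice algebra_simps)
  define a where "a = 2 *s m + h"
  have "adj a (a + pt u)"
    using u by (auto simp: E_eq)
  moreover have "2 *s a = 4 *s m + pt (hd D)" "2 *s (a + pt u) = 4 *s m + pt (last D)"
    by (simp_all add: a_def h l vec_eq_iff algebra_simps)
  ultimately show ?thesis
    using that \<C>_path_place[OF D, of m] by metis
qed

lemma \<C>_path_rev:
  assumes "adj a b"
  shows "\<C>_path (2 *s b) (2 *s a) = rev (\<C>_path (2 *s a) (2 *s b))"
proof -
  obtain m D where D: "D \<in> set paths" "2 *s a = 4 *s m + pt (hd D)" "2 *s b = 4 *s m + pt (last D)"
    "\<C>_path (2 *s a) (2 *s b) = place m D"
    using key_exists[OF assms] .
  have "hd (rev D) = last D" "last (rev D) = hd D"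
    by (simp_all add: hd_rev last_rev)
  then show ?thesis
    using \<C>_path_place[OF rev_paths[OF D(1)], of m] D by (simp add: place_def rev_map)
qed

lemma \<C>_path_props:
  assumes "adj a b"
  shows "length (\<C>_path (2 *s a) (2 *s b)) = 9" "hd (\<C>_path (2 *s a) (2 *s b)) = 2 *s a"
    "last (\<C>_path (2 *s a) (2 *s b)) = 2 *s b"
  by (rule key_exists[OF assms]; simp add: good_pathD(1) hd_place last_place; simp add: place_def good_pathD(1))+

section \<open>Steps and corners of refined curves\<close>

abbreviation lsteps :: "point list \<Rightarrow> (point \<times> point) set" where
  "lsteps xs \<equiv> steps (Fin_curve xs)"

abbreviation lcorners :: "point list \<Rightarrow> (point \<times> point \<times> point) set" where
  "lcorners xs \<equiv> corners (Fin_curve xs)"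

lemma lsteps_simps:
  "lsteps [] = {}" "lsteps [x] = {}"
  "lsteps (x # y # zs) = insert (x, y) (lsteps (y # zs))"
proof -
  show "lsteps (x # y # zs) = insert (x, y) (lsteps (y # zs))" (is "?L = ?R")
  proof (intro set_eqI iffI)
    fix p assume "p \<in> ?L"
    then obtain k where "p = ((x # y # zs) ! k, (x # y # zs) ! (k + 1))" "k + 1 < length (x # y # zs)"
      by auto
    then show "p \<in> ?R"
      by (cases k) auto
  next
    fix p assume "p \<in> ?R"
    then consider "p = (x, y)" | k where "p = ((y # zs) ! k, (y # zs) ! (k + 1))" "k + 1 < length (y # zs)"
      by auto
    then show "p \<in> ?L"
    proof cases
      case 1
      then show ?thesis by (auto intro!: exI[of _ 0])
    next
      case (2 k)
      then show ?thesis by (auto intro!: exI[of _ "Suc k"])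
    qed
  qed
qed simp_all

lemma lcorners_simps:
  "lcorners [] = {}" "lcorners [x] = {}" "lcorners [x, y] = {}"
  "lcorners (x # y # z # zs) = insert (x, y, z) (lcorners (y # z # zs))"
proof -
  show "lcorners (x # y # z # zs) = insert (x, y, z) (lcorners (y # z # zs))" (is "?L = ?R")
  proof (intro set_eqI iffI)
    fix p assume "p \<in> ?L"
    then obtain k where "p = ((x # y # z # zs) ! k, (x # y # z # zs) ! (k + 1), (x # y # z # zs) ! (k + 2))"
      "k + 2 < length (x # y # z # zs)"
      by auto
    then show "p \<in> ?R"
      by (cases k) auto
  next
    fix p assume "p \<in> ?R"
    then consider "p = (x, y, z)"
      | k where "p = ((y # z # zs) ! k, (y # z # zs) ! (k + 1), (y # z # zs) ! (k + 2))" "k + 2 < length (y # z # zs)"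
      by auto
    then show "p \<in> ?L"
    proof cases
      case 1
      then show ?thesis by (auto intro!: exI[of _ 0])
    next
      case (2 k)
      then show ?thesis by (auto intro!: exI[of _ "Suc k"])
    qed
  qed
qed simp_all

lemma lsteps_glue:
  assumes "P \<noteq> []" "last P = q"
  shows "lsteps (butlast P @ q # Q) = lsteps P \<union> lsteps (q # Q)"
  using assms
proof (induction P rule: induct_list012)
  case (3 x y zs)
  then show ?case
    by (cases zs) (auto simp: lsteps_simps simp del: steps.simps)
qed (auto simp: lsteps_simps simp del: steps.simps)

text \<open>Joining two paths at \<open>q\<close> creates exactly one new corner, from the
  penultimate vertex of the first through \<open>q\<close> to the second vertex of the
  other.\<close>

lemma lcorners_glue:
  assumes "length P \<ge> 2" "last P = q"
  shows "lcorners (butlast P @ q # r # Q)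
    = lcorners P \<union> lcorners (q # r # Q) \<union> {(P ! (length P - 2), q, r)}"
  using assms
proof (induction P rule: induct_list012)
  case (3 x y zs)
  show ?case
  proof (cases zs)
    case Nil
    then show ?thesis
      using 3 by (auto simp: lcorners_simps simp del: corners.simps)
  next
    case (Cons z zs')
    have "lcorners (butlast (y # zs) @ q # r # Q)
        = lcorners (y # zs) \<union> lcorners (q # r # Q) \<union> {((y # zs) ! (length (y # zs) - 2), q, r)}"
      using 3 Cons by (intro "3.IH") auto
    moreover have "butlast (x # y # zs) @ q # r # Q = x # butlast (y # zs) @ q # r # Q"
      by simp
    \<comment> \<open>The vertex after \<open>y\<close> is \<open>z\<close> in either case: if
      \<open>z\<close> is dropped by \<open>butlast\<close>, it comes back as
      \<open>q\<close>.\<close>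
    moreover have "\<exists>w ws. butlast (y # zs) @ q # r # Q = y # w # ws \<and> (zs' \<noteq> [] \<longrightarrow> w = z) \<and> (zs' = [] \<longrightarrow> w = q)"
      using Cons by (cases zs') auto
    moreover have "zs' = [] \<Longrightarrow> q = z"
      using 3 Cons by simp
    ultimately show ?thesis
      using Cons by (auto simp: lcorners_simps nth_Cons' simp del: corners.simps)
  qed
qed auto

section \<open>Refinement of paths with unit steps\<close>

definition chain :: "point list \<Rightarrow> bool" where
  "chain xs \<longleftrightarrow> length xs \<ge> 2 \<and> (\<forall>(a, b) \<in> lsteps xs. adj a b)"

definition route :: "point \<Rightarrow> point \<Rightarrow> point list" where
  "route a b = \<C>_path (2 *s a) (2 *s b)"

lemma route_rev: "adj a b \<Longrightarrow> route b a = rev (route a b)"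
  by (simp add: route_def \<C>_path_rev)

lemmas route_props = \<C>_path_props[folded route_def]

text \<open>A corner of the refinement either lies inside one route or sits where two routes meet.
  In the second case, reversing the incoming route shows both neighbours of \<open>2b\<close> as
  second vertices of routes leaving \<open>2b\<close>.\<close>

lemma refine_chain:
  assumes "chain xs"
  shows "\<exists>zs. refine xs = 2 *s (xs ! 0) # route (xs ! 0) (xs ! 1) ! 1 # zs \<and> zs \<noteq> []"
    and "lsteps (refine xs) = (\<Union>(a, b) \<in> lsteps xs. lsteps (route a b))"
    and "lcorners (refine xs) = (\<Union>(a, b) \<in> lsteps xs. lcorners (route a b))
      \<union> {(route b a ! 1, 2 *s b, route b d ! 1) | a b d. (a, b, d) \<in> lcorners xs}"
proof -
  \<comment> \<open>The three claims go through the induction together, since gluing requires the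
    first two vertices of the refined tail.\<close>
  define P where "P xs \<longleftrightarrow> (\<exists>zs. refine xs = 2 *s (xs ! 0) # route (xs ! 0) (xs ! 1) ! 1 # zs \<and> zs \<noteq> [])
    \<and> lsteps (refine xs) = (\<Union>(a, b) \<in> lsteps xs. lsteps (route a b))
    \<and> lcorners (refine xs) = (\<Union>(a, b) \<in> lsteps xs. lcorners (route a b))
      \<union> {(route b a ! 1, 2 *s b, route b d ! 1) | a b d. (a, b, d) \<in> lcorners xs}" for xs
  have "chain xs \<Longrightarrow> P xs"
  proof (induction xs rule: induct_list012)
    case (3 x y zs)
    have adj: "adj x y"
      using 3 by (auto simp: chain_def lsteps_simps simp del: steps.simps)
    note R = route_props[OF adj]
    obtain r0 r1 r2 rs where r: "route x y = r0 # r1 # r2 # rs" "rs \<noteq> []"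
      using R(1) by (auto simp: numeral_eq_Suc length_Suc_conv)
    have r0: "r0 = 2 *s x" using R r by simp
    have ref: "refine (x # y # zs) = butlast (route x y) @ refine (y # zs)"
      by (simp add: route_def)
    have start: "\<exists>zs'. refine (x # y # zs) = 2 *s x # r1 # zs' \<and> zs' \<noteq> []"
      unfolding ref using r r0 by auto
    show ?case
    proof (cases zs)
      case Nil
      have "butlast (route x y) @ [2 *s y] = route x y"
        using R(3) r by (metis append_butlast_last_id list.distinct(1))
      then have "refine (x # y # zs) = route x y"
        unfolding ref using Nil by simp
      then show ?thesis
        using start Nil r r0 by (auto simp: P_def lsteps_simps lcorners_simps simp del: steps.simps corners.simps)
    next
      case (Cons z zs')
      have "chain (y # zs)"
        using 3 Cons by (auto simp: chain_def lsteps_simps simp del: steps.simps)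
      then have IH: "P (y # zs)" by (rule 3)
      then obtain ws where ws: "refine (y # zs) = 2 *s y # route y z ! 1 # ws" "ws \<noteq> []"
        using Cons by (auto simp: P_def)
      have st: "lsteps (refine (x # y # zs)) = lsteps (route x y) \<union> lsteps (refine (y # zs))"
        unfolding ref ws using R r by (intro lsteps_glue) auto
      have "lcorners (refine (x # y # zs)) = lcorners (route x y) \<union> lcorners (refine (y # zs))
          \<union> {(route x y ! (length (route x y) - 2), 2 *s y, route y z ! 1)}"
        unfolding ref ws using R by (intro lcorners_glue) auto
      moreover have "route x y ! (length (route x y) - 2) = route y x ! 1"
        unfolding route_rev[OF adj] using R(1) by (simp add: rev_nth)
      ultimately have co: "lcorners (refine (x # y # zs)) = lcorners (route x y) \<union> lcorners (refine (y # zs))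
          \<union> {(route y x ! 1, 2 *s y, route y z ! 1)}"
        by simp
      have s2: "lsteps (x # y # zs) = insert (x, y) (lsteps (y # zs))"
        and c2: "lcorners (x # y # zs) = insert (x, y, z) (lcorners (y # zs))"
        by (simp_all add: Cons lsteps_simps lcorners_simps del: steps.simps corners.simps)
      have IHs: "lsteps (refine (y # zs)) = (\<Union>(a, b) \<in> lsteps (y # zs). lsteps (route a b))"
        and IHc: "lcorners (refine (y # zs)) = (\<Union>(a, b) \<in> lsteps (y # zs). lcorners (route a b))
          \<union> {(route b a ! 1, 2 *s b, route b d ! 1) | a b d. (a, b, d) \<in> lcorners (y # zs)}"
        using IH by (simp_all only: P_def)
      have "{(route b a ! 1, 2 *s b, route b d ! 1) | a b d. (a, b, d) \<in> insert (x, y, z) X}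
          = {(route b a ! 1, 2 *s b, route b d ! 1) | a b d. (a, b, d) \<in> X}
            \<union> {(route y x ! 1, 2 *s y, route y z ! 1)}" for X
        by auto
      then have "lcorners (refine (x # y # zs)) = (\<Union>(a, b) \<in> lsteps (x # y # zs). lcorners (route a b))
          \<union> {(route b a ! 1, 2 *s b, route b d ! 1) | a b d. (a, b, d) \<in> lcorners (x # y # zs)}"
        unfolding co IHc c2 s2 by (simp only: UN_insert split_conv Un_assoc)
      moreover have "lsteps (refine (x # y # zs)) = (\<Union>(a, b) \<in> lsteps (x # y # zs). lsteps (route a b))"
        unfolding st IHs s2 by (simp only: UN_insert split_conv)
      moreover have "\<exists>zs'. refine (x # y # zs) = 2 *s ((x # y # zs) ! 0) # route ((x # y # zs) ! 0) ((x # y # zs) ! 1) ! 1 # zs' \<and> zs' \<noteq> []"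
        using start r by (simp del: refine.simps)
      ultimately show ?thesis
        unfolding P_def by blast
    qed
  qed (auto simp: chain_def)
  then have "P xs" using assms by blast
  then show "\<exists>zs. refine xs = 2 *s (xs ! 0) # route (xs ! 0) (xs ! 1) ! 1 # zs \<and> zs \<noteq> []"
    and "lsteps (refine xs) = (\<Union>(a, b) \<in> lsteps xs. lsteps (route a b))"
    and "lcorners (refine xs) = (\<Union>(a, b) \<in> lsteps xs. lcorners (route a b))
      \<union> {(route b a ! 1, 2 *s b, route b d ! 1) | a b d. (a, b, d) \<in> lcorners xs}"
    by (simp_all only: P_def)
qed

section \<open>Turns\<close>

lemma coords_diff [simp]: "coords (pt s - pt t) = diff3 s t"
  by (simp flip: pt_diff3)

text \<open>One representative \<open>t\<close> of the class serves all placements, so that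
  \<open>m\<close> can afterwards be chosen to put the corner at a prescribed point.\<close>

lemma turns_place:
  "(p, u, v) \<in> set (turns D) \<Longrightarrow>
    \<exists>t. mod4 t = p \<and> (\<forall>m. (4 *s m + pt t + pt u, 4 *s m + pt t, 4 *s m + pt t + pt v) \<in> lcorners (place m D))"
proof (induction D rule: turns.induct)
  case (1 a b d xs)
  then consider "(p, u, v) = (mod4 b, diff3 a b, diff3 d b)" | "(p, u, v) \<in> set (turns (b # d # xs))"
    by auto
  then show ?case
  proof cases
    case 1
    then show ?thesis
      by (intro exI[of _ b]) (simp add: place_def lcorners_simps pt_diff3 del: corners.simps)
  next
    case 2
    with 1 show ?thesis
      by (fastforce simp: place_def lcorners_simps simp del: corners.simps)
  qed
qed auto

lemma lcorners_place:
  "(x, y, z) \<in> lcorners (place m D) \<Longrightarrow> (mod4 (coords y), coords (x - y), coords (z - y)) \<in> set (turns D)"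
proof (induction D rule: turns.induct)
  case (1 a b d xs)
  then show ?case by (auto simp: place_def lcorners_simps simp del: corners.simps)
qed (auto simp: place_def lcorners_simps simp del: corners.simps)

lemma lsteps_place:
  "(x, y) \<in> lsteps (place m D) \<Longrightarrow> coords (y - x) \<in> set (increments D)"
proof (induction D rule: increments.induct)
  case (1 a b xs)
  then show ?case by (auto simp: place_def lsteps_simps simp del: steps.simps)
qed (auto simp: place_def lsteps_simps simp del: steps.simps)

lemma turns_inner: "(p, u, v) \<in> set (turns D) \<Longrightarrow> p \<in> mod4 ` set (butlast (tl D))"
  by (induction D rule: turns.induct) auto

text \<open>Turns occur at inner vertices of listed paths only, and \<open>good_path\<close>
  excludes even inner vertices.\<close>

lemma turning_not_even:
  assumes "turning p u v"
  shows "\<not> even3 p"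
proof -
  obtain D where D: "D \<in> set paths" "(p, u, v) \<in> set (turns D)"
    using assms by (auto simp: turning_def turn_list_def)
  then obtain q where "q \<in> set (butlast (tl D))" "p = mod4 q"
    using turns_inner by blast
  then show ?thesis
    using good_pathD(5)[OF D(1)] by simp
qed

lemma turning_swap: "turning p u v \<Longrightarrow> turning p v u"
  using turning_swap_all by (auto simp: list_all_iff turning_def)

lemma turning_exists:
  assumes "\<not> evn y" "u \<in> E"
  shows "\<exists>v \<in> E. v \<noteq> u \<and> turning (mod4 (coords y)) (coords u) (coords v)"
proof -
  have "total_at (mod4 (coords y))"
    using turning_total mod4_in_cube by (simp add: list_all_iff)
  then obtain w where "w \<in> set dirs" "coords u \<noteq> w" "turning (mod4 (coords y)) (coords u) w"
    using assms by (auto simp: total_at_def even3_coords coords_E)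
  then show ?thesis
    by (intro bexI[of _ "pt w"]) (auto simp: coords_E)
qed

text \<open>There are as many turns as pairs of a class and a direction, so totality implies uniqueness.\<close>

lemma turning_unique:
  assumes "turning p u v" "turning p u w"
  shows "v = w"
proof -
  \<comment> \<open>The 336 pairs of a class that is not even and a direction; \<open>f\<close> maps
    the turns onto a set containing all of them.\<close>
  define ps where "ps = List.product (filter (\<lambda>p. \<not> even3 p) (cube [0, 1, 2, 3])) dirs"
  define f where "f = (\<lambda>(p, u, v :: triple). (p, u) :: triple \<times> triple)"
  have "distinct ps"
    unfolding ps_def cube_def by (intro distinct_product distinct_filter) (simp_all add: dirs_def)
  moreover have "length ps = 336"
    unfolding ps_def by code_simp
  moreover have "set ps \<subseteq> f ` set turn_list"
  proof
    fix x assume "x \<in> set ps"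
    then obtain p u where x: "x = (p, u)" and *: "p \<in> set (cube [0, 1, 2, 3])" "\<not> even3 p" "u \<in> set dirs"
      unfolding ps_def set_product by auto
    then have "total_at p"
      using turning_total by (simp add: list_all_iff)
    then obtain v where "turning p u v"
      using * unfolding total_at_def by blast
    then show "x \<in> f ` set turn_list"
      unfolding x by (force simp: turning_def f_def)
  qed
  ultimately have "336 \<le> card (f ` set turn_list)"
    by (metis List.finite_set card_mono distinct_card finite_imageI)
  moreover have "card (set turn_list) \<le> 336"
    using card_length[of turn_list] by (simp add: length_turn_list)
  ultimately have "card (f ` set turn_list) = card (set turn_list)"
    using card_image_le[of "set turn_list" f] by simp
  then have "inj_on f (set turn_list)"
    by (intro eq_card_imp_inj_on) auto
  from inj_onD[OF this, of "(p, u, v)" "(p, u, w)"] show ?thesis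
    using assms by (auto simp: turning_def f_def)
qed

lemma routeE:
  assumes "adj a b"
  obtains m D where "D \<in> set paths" "2 *s a = 4 *s m + pt (hd D)" "2 *s b = 4 *s m + pt (last D)"
    "route a b = place m D"
  using key_exists[OF assms] unfolding route_def by blast

lemma route_steps: "adj a b \<Longrightarrow> (x, y) \<in> lsteps (route a b) \<Longrightarrow> adj x y"
  by (rule routeE, assumption) (use good_pathD(4) lsteps_place in \<open>fastforce simp: adj_def coords_E\<close>)

lemma lcornersD: "(x, y, z) \<in> lcorners xs \<Longrightarrow> (x, y) \<in> lsteps xs \<and> (y, z) \<in> lsteps xs"
  by fastforce

text \<open>The placed paths are exactly the routes, by \<open>place_ends\<close> and
  \<open>routeE\<close>, and translating a placed path by a multiple of 4 leaves its turns
  unchanged.\<close>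

lemma turning_iff:
  "turning (mod4 (coords y)) (coords u) (coords v) \<longleftrightarrow> (\<exists>a b. adj a b \<and> (y + u, y, y + v) \<in> lcorners (route a b))"
proof
  assume "turning (mod4 (coords y)) (coords u) (coords v)"
  then obtain D where D: "D \<in> set paths" "(mod4 (coords y), coords u, coords v) \<in> set (turns D)"
    by (auto simp: turning_def turn_list_def)
  then obtain t where t: "mod4 t = mod4 (coords y)"
    "\<And>m. (4 *s m + pt t + u, 4 *s m + pt t, 4 *s m + pt t + v) \<in> lcorners (place m D)"
    using turns_place[OF D(2)] by auto
  then obtain m where "y = 4 *s m + pt t"
    using mod4_eq_iff[of "coords y" t] by auto
  then have "(y + u, y, y + v) \<in> lcorners (place m D)"
    using t(2) by simp
  then show "\<exists>a b. adj a b \<and> (y + u, y, y + v) \<in> lcorners (route a b)"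
    using place_ends[OF D(1), of m] unfolding route_def by metis
next
  assume "\<exists>a b. adj a b \<and> (y + u, y, y + v) \<in> lcorners (route a b)"
  then obtain a b where "adj a b" "(y + u, y, y + v) \<in> lcorners (route a b)"
    by blast
  then obtain m D where "D \<in> set paths" "(y + u, y, y + v) \<in> lcorners (place m D)"
    using routeE by metis
  then show "turning (mod4 (coords y)) (coords u) (coords v)"
    using lcorners_place[of "y + u" y "y + v"] by (auto simp: turning_def turn_list_def)
qed

lemma turning_E:
  assumes "turning (mod4 (coords y)) (coords u) (coords v)"
  shows "u \<in> E" "v \<in> E"
proof -
  obtain a b where "adj a b" "(y + u, y, y + v) \<in> lcorners (route a b)"
    using assms turning_iff by blast
  then have "adj (y + u) y" "adj y (y + v)"
    using route_steps lcornersD by blast+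
  then show "u \<in> E" "v \<in> E"
    by simp_all
qed

text \<open>One end of the segment is not even. There the segment is part of a turn, and swapping
  the turn provides the other orientation.\<close>

lemma route_covers:
  assumes "adj a b"
  shows "\<exists>c d. adj c d \<and> (a, b) \<in> lsteps (route c d)"
proof -
  have *: "\<exists>c d. adj c d \<and> (y, y + u) \<in> lsteps (route c d) \<and> (\<exists>c d. adj c d \<and> (y + u, y) \<in> lsteps (route c d))"
    if "u \<in> E" "\<not> evn y" for y u
    using turning_exists[OF that(2,1)] turning_swap turning_iff lcornersD by metis
  show ?thesis
    using adj_not_evn[OF assms] *[of "b - a" a] *[of "a - b" b] assms adj_sym[OF assms]
    by (auto simp: adj_def)
qed

section \<open>First steps\<close>

definition \<phi> :: "point \<Rightarrow> point \<Rightarrow> point" where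
  "\<phi> c u = route c (c + u) ! 1 - 2 *s c"

lemma \<phi>_place:
  assumes "D \<in> set paths" "2 *s c = 4 *s m + pt (hd D)" "route c (c + u) = place m D"
  shows "\<phi> c u = pt (diff3 (D ! 1) (hd D))"
  using assms good_pathD(1)[OF assms(1)] by (simp add: \<phi>_def place_def pt_diff3)

lemma \<phi>_E:
  assumes "u \<in> E"
  shows "\<phi> c u \<in> E"
proof -
  have adj: "adj c (c + u)" using assms by simp
  then obtain r0 r1 rs where "route c (c + u) = r0 # r1 # rs" "r0 = 2 *s c"
    using route_props[OF adj] by (auto simp: numeral_eq_Suc length_Suc_conv)
  then have "adj (2 *s c) (route c (c + u) ! 1)"
    using route_steps[OF adj] by (auto simp: lsteps_simps simp del: steps.simps)
  then show ?thesis
    by (simp add: \<phi>_def adj_def)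
qed

text \<open>The class of \<open>2c\<close> and the first direction determine the listed path, hence
  its far end \<open>2c + 2u\<close> and so \<open>u\<close>.\<close>

lemma \<phi>_inj: "inj_on (\<phi> c) E"
proof
  fix u v assume "u \<in> E" "v \<in> E" and eq: "\<phi> c u = \<phi> c v"
  then have adj: "adj c (c + u)" "adj c (c + v)" by simp_all
  obtain m D where D: "D \<in> set paths" "2 *s c = 4 *s m + pt (hd D)" "2 *s (c + u) = 4 *s m + pt (last D)"
    "route c (c + u) = place m D"
    using routeE[OF adj(1)] .
  obtain m' D' where D': "D' \<in> set paths" "2 *s c = 4 *s m' + pt (hd D')" "2 *s (c + v) = 4 *s m' + pt (last D')"
    "route c (c + v) = place m' D'"
    using routeE[OF adj(2)] .
  have "mod4 (hd D) = mod4 (hd D')"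
    using D(2) D'(2) by (metis coords_pt mod4_shift)
  moreover have "diff3 (D ! 1) (hd D) = diff3 (D' ! 1) (hd D')"
    using eq \<phi>_place[OF D(1,2,4)] \<phi>_place[OF D'(1,2,4)] by (simp add: pt_eq_iff)
  ultimately have "D = D'"
    using inj_on_first_key D(1) D'(1) by (auto simp: first_key_def inj_on_def)
  then have "2 *s (c + u) = 2 *s (c + v)"
    using D(2,3) D'(2,3) by (metis add_right_cancel)
  then show "u = v"
    by (simp add: vec_eq_iff)
qed

lemma \<phi>_surj: "\<phi> c ` E = E"
  using \<phi>_E \<phi>_inj finite_E by (intro endo_inj_surj) auto

text \<open>Moving \<open>c\<close> by \<open>2k\<close> moves the route by \<open>4k\<close>, a
  period of \<C>.\<close>

lemma \<phi>_shift:
  assumes "u \<in> E"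
  shows "\<phi> (2 *s k + c) u = \<phi> c u"
proof -
  have adj: "adj c (c + u)" using assms by simp
  obtain m D where D: "D \<in> set paths" "2 *s c = 4 *s m + pt (hd D)" "2 *s (c + u) = 4 *s m + pt (last D)"
    "route c (c + u) = place m D"
    using routeE[OF adj] .
  have h: "2 *s (2 *s k + c) = 4 *s (k + m) + pt (hd D)" "2 *s (2 *s k + c + u) = 4 *s (k + m) + pt (last D)"
    using D(2,3) by (simp_all add: vec_eq_iff)
  have "route (2 *s k + c) (2 *s k + c + u) = place (k + m) D"
    unfolding route_def h by (rule \<C>_path_place[OF D(1)])
  then show ?thesis
    using \<phi>_place[OF D(1,2,4)] \<phi>_place[OF D(1) h(1)] by simp
qed

lemma theta3_invol: "theta3 (theta3 t) = t"
  by (cases t) simp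

lemma \<theta>_eq: "\<theta> u = pt (theta3 (coords u))"
proof -
  have pts: "axis 1 1 = pt (1, 0, 0)" "axis 2 1 = pt (0, 1, 0)" "axis 3 1 = pt (0, 0, 1)"
    by (auto simp: vec_eq_iff forall_3 axis_def)
  have neg: "- pt (a, b, c) = pt (- a, - b, - c)" for a b c
    by (simp add: vec_eq_iff forall_3)
  obtain a b c where "coords u = (a, b, c)"
    by (cases "coords u")
  moreover have "u = pt (coords u)"
    by simp
  ultimately show ?thesis
    unfolding \<theta>_def pts by (simp only: neg minus_zero pt_eq_iff theta3.simps if_distrib[of pt] coords_pt)
qed

lemma \<theta>_invol [simp]: "\<theta> (\<theta> u) = u"
  by (simp add: \<theta>_eq theta3_invol)

lemma \<theta>_E [simp]: "\<theta> u \<in> E \<longleftrightarrow> u \<in> E"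
proof -
  have "u \<in> E \<Longrightarrow> \<theta> u \<in> E" for u
    unfolding coords_E \<theta>_eq coords_pt by (auto simp: dirs_def)
  from this[of u] this[of "\<theta> u"] show ?thesis by auto
qed

text \<open>The route leaves a multiple of 4, where \<open>starts_with_theta\<close> applies; it
  expresses \<open>u\<close> through the first direction, and the involution \<theta> inverts
  this.\<close>

lemma \<phi>_even:
  assumes "u \<in> E"
  shows "\<phi> (2 *s c) u = \<theta> u"
proof -
  have adj: "adj (2 *s c) (2 *s c + u)" using assms by simp
  obtain m D where D: "D \<in> set paths" "2 *s (2 *s c) = 4 *s m + pt (hd D)" "2 *s (2 *s c + u) = 4 *s m + pt (last D)"
    "route (2 *s c) (2 *s c + u) = place m D"
    using routeE[OF adj] .
  \<comment> \<open>The summand 0 brings the point into the form required by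
    \<open>mod4_shift\<close>.\<close>
  have "mod4 (hd D) = mod4 (coords (4 *s c + 0))"
    using D(2) mod4_shift[of m "pt (hd D)"] by (simp add: mult.assoc[symmetric])
  then have "mod4 (hd D) = (0, 0, 0)"
    unfolding mod4_shift by (simp add: coords_def)
  then have eq: "diff3 (last D) (hd D) = twice (theta3 (diff3 (D ! 1) (hd D)))"
    using starts_with_theta D(1) by (simp add: list_all_iff starts_with_theta_def)
  have "2 *s u = pt (diff3 (last D) (hd D))"
    unfolding pt_diff3 using D(2,3) by (simp add: vec_eq_iff algebra_simps) 
  also have "\<dots> = 2 *s \<theta> (\<phi> (2 *s c) u)"
    unfolding eq \<phi>_place[OF D(1,2,4)] by (simp add: \<theta>_eq pt_twice)
  finally have "u = \<theta> (\<phi> (2 *s c) u)"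
    by (simp add: vec_eq_iff)
  then show ?thesis
    by (metis \<theta>_invol)
qed

section \<open>Connexions of the limit\<close>

text \<open>Segments are unordered sets, so the middle vertex has to be recovered: two distinct
  segments have at most one common endpoint.\<close>

lemma connected_iff:
  assumes "\<And>c a b d. c \<in> \<E> \<Longrightarrow> (a, b, d) \<in> corners c \<Longrightarrow> adj a b \<and> adj b d \<and> a \<noteq> d"
    and "adj y a" "adj y b"
  shows "connected \<E> {y, a} {y, b} \<longleftrightarrow> (\<exists>c \<in> \<E>. (a, y, b) \<in> corners c \<or> (b, y, a) \<in> corners c)"
proof
  assume "connected \<E> {y, a} {y, b}"
  then obtain c a' b' d' where c: "c \<in> \<E>" "(a', b', d') \<in> corners c"
    "{y, a} = {a', b'} \<and> {y, b} = {b', d'} \<or> {y, a} = {b', d'} \<and> {y, b} = {a', b'}"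
    by (auto simp: connected_def)
  have "a' \<noteq> b'" "b' \<noteq> d'" "a' \<noteq> d'" "y \<noteq> a" "y \<noteq> b"
    using assms(1)[OF c(1,2)] assms(2,3) adj_neq by blast+
  then have "(a', b', d') = (a, y, b) \<or> (a', b', d') = (b, y, a)"
    using c(3) by (auto simp: doubleton_eq_iff)
  then show "\<exists>c \<in> \<E>. (a, y, b) \<in> corners c \<or> (b, y, a) \<in> corners c"
    using c(1,2) by blast
next
  assume "\<exists>c \<in> \<E>. (a, y, b) \<in> corners c \<or> (b, y, a) \<in> corners c"
  then show "connected \<E> {y, a} {y, b}"
    unfolding connected_def by (fastforce simp: insert_commute)
qed

lemma \<C>_power_chain: "c \<in> \<C>_power n \<Longrightarrow> \<exists>xs. c = Fin_curve xs \<and> chain xs"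
proof (induction n arbitrary: c)
  case 0
  then show ?case
    by (auto simp: chain_def lsteps_simps segments_iff simp del: steps.simps)
next
  case (Suc n)
  then obtain xs where xs: "c = Fin_curve (refine xs)" "Fin_curve xs \<in> \<C>_power n"
    by (auto simp: star_def)
  then have ch: "chain xs"
    using Suc.IH by blast
  have "adj x y" if "(x, y) \<in> lsteps (refine xs)" for x y
    using that ch route_steps unfolding refine_chain(2)[OF ch] by (fastforce simp: chain_def simp del: steps.simps)
  moreover have "length (refine xs) \<ge> 2"
    using refine_chain(1)[OF ch] by auto
  ultimately show ?case
    using xs(1) by (auto simp: chain_def simp del: steps.simps)
qed

text \<open>Guarantees that every route, and with it every turn, appears in the next power. The
  orientation is kept, as power 0 contains each segment in both orientations.\<close>

lemma \<C>_power_covers: "adj a b \<Longrightarrow> \<exists>xs. Fin_curve xs \<in> \<C>_power n \<and> (a, b) \<in> lsteps xs"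
proof (induction n arbitrary: a b)
  case 0
  then show ?case
    by (intro exI[of _ "[a, b]"]) (auto simp: lsteps_simps segments_iff simp del: steps.simps)
next
  case (Suc n)
  obtain c d where cd: "adj c d" "(a, b) \<in> lsteps (route c d)"
    using route_covers[OF Suc.prems] by blast
  obtain xs where xs: "Fin_curve xs \<in> \<C>_power n" "(c, d) \<in> lsteps xs"
    using Suc.IH[OF cd(1)] by blast
  then have "chain xs"
    using \<C>_power_chain by blast
  then have "(a, b) \<in> lsteps (refine xs)"
    using refine_chain(2) cd(2) xs(2) by blast
  then show ?case
    using xs(1) by (auto simp: star_def simp del: steps.simps)
qed

definition power_corners :: "nat \<Rightarrow> (point \<times> point \<times> point) set" where
  "power_corners n = (\<Union>c \<in> \<C>_power n. corners c)"

lemma power_corners_adj: "(a, b, d) \<in> power_corners n \<Longrightarrow> adj a b \<and> adj b d"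
  using \<C>_power_chain[of _ n] lcornersD[of a b d]
  by (fastforce simp: power_corners_def chain_def simp del: steps.simps corners.simps)

lemma power_corners_0: "power_corners 0 = {}"
  by (auto simp: power_corners_def)

text \<open>The recursion behind everything that follows, read off from \<open>refine_chain\<close>:
  corners inside routes are the turns of \<C>, the others are images under \<open>\<phi> c\<close>
  of corners of the previous power.\<close>

lemma power_corners_Suc:
  "(y + u, y, y + v) \<in> power_corners (Suc n) \<longleftrightarrow> turning (mod4 (coords y)) (coords u) (coords v) \<or>
    (\<exists>c. \<exists>u' \<in> E. \<exists>v' \<in> E. y = 2 *s c \<and> u = \<phi> c u' \<and> v = \<phi> c v' \<and> (c + u', c, c + v') \<in> power_corners n)"
  (is "?L \<longleftrightarrow> ?T \<or> ?R")
proof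
  assume ?L
  then obtain xs where xs: "Fin_curve xs \<in> \<C>_power n" "(y + u, y, y + v) \<in> lcorners (refine xs)"
    by (auto simp: power_corners_def star_def simp del: corners.simps)
  then have ch: "chain xs"
    using \<C>_power_chain by blast
  from xs(2) consider a b where "(a, b) \<in> lsteps xs" "(y + u, y, y + v) \<in> lcorners (route a b)"
    | a b d where "(a, b, d) \<in> lcorners xs" "y + u = route b a ! 1" "y = 2 *s b" "y + v = route b d ! 1"
    unfolding refine_chain(3)[OF ch] by blast
  then show "?T \<or> ?R"
  proof cases
    case 1
    then have "adj a b"
      using ch by (auto simp: chain_def simp del: steps.simps)
    then show ?thesis
      using 1 turning_iff by blast
  next
    case 2
    have pc: "(a, b, d) \<in> power_corners n"
      using xs(1) 2(1) by (auto simp: power_corners_def simp del: corners.simps)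
    have "a - b \<in> E" "d - b \<in> E"
      using power_corners_adj[OF pc] adj_sym by (auto simp: adj_def)
    moreover have "u = \<phi> b (a - b)" "v = \<phi> b (d - b)"
      using 2 by (simp_all add: \<phi>_def algebra_simps)
    ultimately have ?R
      using pc 2(3) by (intro exI[of _ b] bexI[of _ "a - b"] bexI[of _ "d - b"]) auto
    then show ?thesis ..
  qed
next
  have intro: "t \<in> power_corners (Suc n)" if "Fin_curve xs \<in> \<C>_power n" "t \<in> lcorners (refine xs)" for t xs
    using that by (auto simp: power_corners_def star_def simp del: corners.simps)
  assume "?T \<or> ?R"
  then show ?L
  proof
    assume ?T
    then obtain a b where ab: "adj a b" "(y + u, y, y + v) \<in> lcorners (route a b)"
      using turning_iff by blast
    obtain xs where xs: "Fin_curve xs \<in> \<C>_power n" "(a, b) \<in> lsteps xs"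
      using \<C>_power_covers[OF ab(1)] by blast
    then have ch: "chain xs"
      using \<C>_power_chain by blast
    show ?L
      using intro[OF xs(1)] ab(2) xs(2) unfolding refine_chain(3)[OF ch] by blast
  next
    assume ?R
    then obtain c u' v' where *: "y = 2 *s c" "u = \<phi> c u'" "v = \<phi> c v'" "(c + u', c, c + v') \<in> power_corners n"
      by blast
    then obtain xs where xs: "Fin_curve xs \<in> \<C>_power n" "(c + u', c, c + v') \<in> lcorners xs"
      using \<C>_power_chain by (force simp: power_corners_def simp del: corners.simps)
    then have ch: "chain xs"
      using \<C>_power_chain by blast
    have "(y + u, y, y + v) = (route c (c + u') ! 1, 2 *s c, route c (c + v') ! 1)"
      using * by (simp add: \<phi>_def)
    then show ?L
      using intro[OF xs(1)] xs(2) unfolding refine_chain(3)[OF ch] by blast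
  qed
qed

lemma power_corners_swap: "(y + u, y, y + v) \<in> power_corners n \<Longrightarrow> (y + v, y, y + u) \<in> power_corners n"
proof (induction n arbitrary: y u v)
  case (Suc n)
  then show ?case
    using turning_swap unfolding power_corners_Suc by blast
qed (simp add: power_corners_0)

text \<open>At a point that is not even, \<open>turning_exists\<close> gives a partner of
  \<open>u\<close> other than \<open>u\<close>, and partners are unique.\<close>

lemma turning_irrefl:
  assumes "turning (mod4 (coords y)) (coords u) (coords v)"
  shows "u \<noteq> v"
proof -
  have "\<not> evn y"
    using turning_not_even[OF assms] by (simp add: even3_coords)
  then obtain w where "w \<noteq> u" "turning (mod4 (coords y)) (coords u) (coords w)"
    using turning_exists turning_E(1)[OF assms] by blast
  then show ?thesis
    using turning_unique[OF assms] by (metis pt_coords)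
qed

lemma power_corners_neq: "(y + u, y, y + v) \<in> power_corners n \<Longrightarrow> u \<noteq> v"
proof (induction n arbitrary: y u v)
  case (Suc n)
  then show ?case
    using turning_irrefl \<phi>_inj unfolding power_corners_Suc inj_on_def by metis
qed (simp add: power_corners_0)

section \<open>Connexions of the limit as relations between directions\<close>

definition joint :: "point \<Rightarrow> point \<Rightarrow> point \<Rightarrow> bool" where
  "joint y u v \<longleftrightarrow> (\<exists>n. (y + u, y, y + v) \<in> power_corners n)"

lemma joint_E: "joint y u v \<Longrightarrow> u \<in> E \<and> v \<in> E"
  using power_corners_adj by (force simp: joint_def)

lemma joint_swap: "joint y u v \<Longrightarrow> joint y v u"
  unfolding joint_def using power_corners_swap by blast

lemma joint_neq: "joint y u v \<Longrightarrow> u \<noteq> v"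
  using power_corners_neq by (auto simp: joint_def)

lemma limit_connected_iff:
  assumes "u \<in> E" "v \<in> E"
  shows "limit_connected {y, y + u} {y, y + v} \<longleftrightarrow> joint y u v"
proof -
  have "connected (\<C>_power n) {y, y + u} {y, y + v} \<longleftrightarrow> (y + u, y, y + v) \<in> power_corners n" for n
  proof -
    have "connected (\<C>_power n) {y, y + u} {y, y + v} \<longleftrightarrow>
      (\<exists>c \<in> \<C>_power n. (y + u, y, y + v) \<in> corners c \<or> (y + v, y, y + u) \<in> corners c)"
    proof (rule connected_iff)
      fix c a b d assume "c \<in> \<C>_power n" "(a, b, d) \<in> corners c"
      then have pc: "(a, b, d) \<in> power_corners n"
        by (auto simp: power_corners_def)
      then show "adj a b \<and> adj b d \<and> a \<noteq> d"
        using power_corners_adj power_corners_neq[of b "a - b" "d - b" n] by auto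
    qed (use assms in simp_all)
    also have "\<dots> \<longleftrightarrow> (y + u, y, y + v) \<in> power_corners n"
      using power_corners_swap[of y v u n] by (auto simp: power_corners_def)
    finally show ?thesis .
  qed
  then show ?thesis
    by (simp add: limit_connected_def joint_def)
qed

lemma R_at_eq: "R_at x = joint x"
  using limit_connected_iff joint_E by (intro ext) (auto simp: R_at_def)

lemma ex_nat_Suc: "\<not> P 0 \<Longrightarrow> (\<exists>n. P n) \<longleftrightarrow> (\<exists>n. P (Suc n))"
  by (metis not0_implies_Suc)

text \<open>The recursive alternative of \<open>power_corners_Suc\<close> needs an even point, so
  all powers from the first on have the same corners at \<open>y\<close>.\<close>

lemma joint_odd:
  assumes "\<not> evn y"
  shows "joint y u v \<longleftrightarrow> turning (mod4 (coords y)) (coords u) (coords v)"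
proof -
  have "\<nexists>c. y = 2 *s c"
    using assms evn_iff by blast
  then show ?thesis
    unfolding joint_def by (subst ex_nat_Suc) (auto simp: power_corners_0 power_corners_Suc)
qed

lemma double_inject: "2 *s a = 2 *s b \<longleftrightarrow> a = (b :: point)"
  by (simp add: vec_eq_iff)

lemma joint_even:
  "joint (2 *s c) u v \<longleftrightarrow> (\<exists>u' \<in> E. \<exists>v' \<in> E. u = \<phi> c u' \<and> v = \<phi> c v' \<and> joint c u' v')"
proof -
  have "evn (2 *s c)"
    using evn_iff by blast
  then have "\<not> turning (mod4 (coords (2 *s c))) (coords u) (coords v)"
    using turning_not_even[of "mod4 (coords (2 *s c))" "coords u" "coords v"] by (auto simp: even3_coords)
  then show ?thesis
    unfolding joint_def
    by (subst ex_nat_Suc) (auto simp: power_corners_0 power_corners_Suc double_inject)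
qed

lemma joint_\<phi>:
  assumes "u \<in> E" "v \<in> E"
  shows "joint (2 *s c) (\<phi> c u) (\<phi> c v) \<longleftrightarrow> joint c u v"
  unfolding joint_even using assms \<phi>_inj[of c] by (auto simp: inj_on_def)

text \<open>Doubling the even point \<open>2c\<close> acts on directions by
  \<open>\<phi> (2c)\<close>, which is \<theta>.\<close>

lemma joint_\<theta>:
  assumes "u \<in> E" "v \<in> E"
  shows "joint (4 *s c) (\<theta> u) (\<theta> v) \<longleftrightarrow> joint (2 *s c) u v"
  using joint_\<phi>[OF assms, of "2 *s c"] by (simp add: \<phi>_even assms)

text \<open>There is no turn at 0, and halving 0 gives 0 again, so a corner at 0 would descend to
  power 0, which has no corners.\<close>

lemma not_joint_0: "\<not> joint 0 u v"
proof -
  have "(0 + u, 0, 0 + v) \<notin> power_corners n" for n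
  proof (induction n arbitrary: u v)
    case (Suc n)
    have "\<not> turning (mod4 (coords 0)) (coords u) (coords v)"
      using turning_not_even[of "mod4 (coords 0)" "coords u" "coords v"] by (auto simp: even3_coords evn_def)
    moreover have "0 = 2 *s c \<Longrightarrow> c = 0" for c :: point
      by (simp add: vec_eq_iff)
    ultimately show ?case
      using Suc unfolding power_corners_Suc by blast
  qed (simp add: power_corners_0)
  then show ?thesis
    by (auto simp: joint_def)
qed

section \<open>Odd parts and periodicity\<close>

lemma odd_part:
  fixes y :: point
  assumes "y \<noteq> 0"
  obtains k w where "y = 2 ^ k *s w" "\<not> evn w"
  using assms
proof (induction "\<Sum>i\<in>UNIV. nat \<bar>y $ i\<bar>" arbitrary: y thesis rule: less_induct)
  case less
  show ?case
  proof (cases "evn y")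
    case True
    then obtain c where c: "y = 2 *s c"
      using evn_iff by blast
    obtain i where "y $ i \<noteq> 0"
      using less.prems(2) by (auto simp: vec_eq_iff)
    then have "(\<Sum>i\<in>UNIV. nat \<bar>c $ i\<bar>) < (\<Sum>i\<in>UNIV. nat \<bar>y $ i\<bar>)"
      by (intro sum_strict_mono_ex1) (auto simp: c intro!: bexI[of _ i])
    moreover have "c \<noteq> 0"
      using c less.prems(2) by auto
    ultimately obtain k w where "c = 2 ^ k *s w" "\<not> evn w"
      using less.hyps by blast
    then show ?thesis
      using less.prems(1)[of "Suc k" w] c by simp
  next
    case False
    then show ?thesis
      using less.prems(1)[of 0 y] by simp
  qed
qed

text \<open>True at the odd part by \<open>turning_exists\<close>, and preserved by each doubling
  because \<open>\<phi>\<close> permutes \<open>E\<close>.\<close>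

lemma joint_exists:
  assumes "y \<noteq> 0" "u \<in> E"
  shows "\<exists>v \<in> E. joint y u v"
proof -
  obtain k w where w: "y = 2 ^ k *s w" "\<not> evn w"
    using odd_part[OF assms(1)] .
  have "u \<in> E \<Longrightarrow> \<exists>v \<in> E. joint (2 ^ k *s w) u v" for u
  proof (induction k arbitrary: u)
    case 0
    then show ?case
      using turning_exists[OF w(2)] joint_odd[OF w(2)] by (simp; blast)
  next
    case (Suc k)
    obtain u' where u': "u' \<in> E" "u = \<phi> (2 ^ k *s w) u'"
      using Suc.prems \<phi>_surj by blast
    then obtain v' where "v' \<in> E" "joint (2 ^ k *s w) u' v'"
      using Suc.IH by blast
    then have "joint (2 *s (2 ^ k *s w)) u (\<phi> (2 ^ k *s w) v')"
      using u' joint_\<phi> by blast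
    then show ?case
      using joint_E by auto
  qed
  then show ?thesis
    using w(1) assms(2) by blast
qed

lemma joint_periodic:
  assumes "\<not> evn w"
  shows "joint (2 ^ k *s (4 *s m + w)) u v \<longleftrightarrow> joint (2 ^ k *s w) u v"
proof (induction k arbitrary: u v)
  case 0
  have "\<not> evn (4 *s m + w)"
    using assms by (simp add: evn_def)
  then show ?case
    using joint_odd assms by simp
next
  case (Suc k)
  \<comment> \<open>The two points agree modulo 2, so \<open>\<phi>\<close> is the same at both and
    doubling preserves the equivalence.\<close>
  have "2 ^ k *s (4 *s m + w) = 2 *s (2 ^ k *s (2 *s m)) + 2 ^ k *s w"
    by (simp add: vec_eq_iff algebra_simps)
  then have "\<phi> (2 ^ k *s (4 *s m + w)) u = \<phi> (2 ^ k *s w) u" if "u \<in> E" for u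
    using \<phi>_shift[OF that] by presburger
  then have "joint (2 *s (2 ^ k *s (4 *s m + w))) u v \<longleftrightarrow> joint (2 *s (2 ^ k *s w)) u v"
    unfolding joint_even Suc.IH by auto
  then show ?case
    by (simp add: mult.assoc)
qed

section \<open>The completed covering\<close>

definition R_joint :: "(point \<Rightarrow> point \<Rightarrow> bool) \<Rightarrow> point \<Rightarrow> point \<Rightarrow> point \<Rightarrow> bool" where
  "R_joint R y u v \<longleftrightarrow> (if y = 0 then R u v else joint y u v)"

lemma pairing_relationD:
  assumes "pairing_relation A R"
  shows "R u v \<Longrightarrow> u \<in> A \<and> v \<in> A \<and> u \<noteq> v \<and> R v u"
    and "u \<in> A \<Longrightarrow> \<exists>v \<in> A. R u v"
proof -
  obtain \<P> where P: "partition_on A \<P>" "\<forall>p \<in> \<P>. card p = 2" "\<forall>u v. R u v \<longleftrightarrow> u \<noteq> v \<and> {u, v} \<in> \<P>"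
    using assms by (auto simp: pairing_relation_def)
  show "R u v \<Longrightarrow> u \<in> A \<and> v \<in> A \<and> u \<noteq> v \<and> R v u"
    using P(1,3) by (auto simp: partition_on_def insert_commute)
  assume "u \<in> A"
  then obtain p where p: "p \<in> \<P>" "u \<in> p"
    using P(1) by (auto simp: partition_on_def)
  then obtain v where "p = {u, v}" "u \<noteq> v"
    using P(2) by (metis card_2_iff insert_iff insert_commute singletonD)
  then show "\<exists>v \<in> A. R u v"
    using P(1,3) p by (auto simp: partition_on_def)
qed

locale pairing =
  fixes R :: "point \<Rightarrow> point \<Rightarrow> bool"
  assumes pairing: "pairing_relation E R"
begin

lemma R_joint_D: "R_joint R y u v \<Longrightarrow> u \<in> E \<and> v \<in> E \<and> u \<noteq> v \<and> R_joint R y v u"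
  using pairing_relationD(1)[OF pairing, of u v] joint_E[of y u v] joint_neq[of y u v] joint_swap[of y u v]
  by (auto simp: R_joint_def split: if_splits)

lemma R_joint_exists: "u \<in> E \<Longrightarrow> \<exists>v. R_joint R y u v"
  using pairing_relationD(2)[OF pairing, of u] joint_exists[of y u] by (auto simp: R_joint_def)

text \<open>The clause for \<open>R\<close> can apply only at \<open>y = 0\<close>: two distinct
  segments issuing from 0 share no other endpoint.\<close>

lemma joined_iff:
  assumes "u \<in> E" "v \<in> E"
  shows "joined R {y, y + u} {y, y + v} \<longleftrightarrow> R_joint R y u v"
proof -
  have "0 \<noteq> u" "0 \<noteq> v"
    using assms zero_notin_E by auto
  moreover have "\<And>u' v'. R u' v' \<Longrightarrow> u' \<noteq> 0 \<and> v' \<noteq> 0 \<and> u' \<noteq> v'"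
    using pairing_relationD(1)[OF pairing] zero_notin_E by metis
  ultimately have "(\<exists>u' v'. R u' v' \<and> {y, y + u} = {0, u'} \<and> {y, y + v} = {0, v'}) \<longleftrightarrow> y = 0 \<and> R u v"
    by (auto simp: doubleton_eq_iff)
  then show ?thesis
    using not_joint_0 by (auto simp: joined_def limit_connected_iff[OF assms] R_joint_def)
qed

definition allowed :: "point \<Rightarrow> point \<Rightarrow> point \<Rightarrow> bool" where
  "allowed a b d \<longleftrightarrow> R_joint R b (a - b) (d - b)"

lemma allowed_D: "allowed a b d \<Longrightarrow> adj a b \<and> adj b d \<and> a \<noteq> d \<and> allowed d b a"
  using R_joint_D[of b "a - b" "d - b"] adj_sym[of b a] by (auto simp: allowed_def adj_def)

lemma allowed_iff:
  assumes "adj a b" "adj b d"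
  shows "allowed a b d \<longleftrightarrow> joined R {a, b} {b, d}"
  using joined_iff[of "a - b" "d - b" b] assms adj_sym[OF assms(1)]
  by (simp add: allowed_def adj_def insert_commute)

text \<open>An allowed corner has unit steps and does not turn back, so \<open>allowed\<close>
  absorbs the requirements of \<open>is_curve\<close>.\<close>

lemma Int_curve_in_\<C>_hat: "Int_curve f \<in> \<C>_hat R \<longleftrightarrow> (\<forall>k. allowed (f k) (f (k + 1)) (f (k + 2)))"
proof
  assume "Int_curve f \<in> \<C>_hat R"
  then have *: "\<And>a b. (a, b) \<in> steps (Int_curve f) \<Longrightarrow> adj a b"
    "\<And>a b d. (a, b, d) \<in> corners (Int_curve f) \<Longrightarrow> joined R {a, b} {b, d}"
    by (auto simp: \<C>_hat_def is_curve_def segments_iff simp del: steps.simps corners.simps)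
  show "\<forall>k. allowed (f k) (f (k + 1)) (f (k + 2))"
  proof
    fix k
    have "adj (f k) (f (k + 1))" "adj (f (k + 1)) (f (k + 2))"
      using *(1)[of "f k" "f (k + 1)"] *(1)[of "f (k + 1)" "f (k + 1 + 1)"] by (force simp: add.assoc)+
    then show "allowed (f k) (f (k + 1)) (f (k + 2))"
      using *(2)[of "f k" "f (k + 1)" "f (k + 2)"] allowed_iff by auto
  qed
next
  assume *: "\<forall>k. allowed (f k) (f (k + 1)) (f (k + 2))"
  then have "adj (f k) (f (k + 1))" "f k \<noteq> f (k + 2)" "joined R {f k, f (k + 1)} {f (k + 1), f (k + 2)}" for k
    using allowed_D allowed_iff by blast+
  then show "Int_curve f \<in> \<C>_hat R"
    by (auto simp: \<C>_hat_def is_curve_def segments_iff)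
qed

lemma \<C>_hat_corner:
  assumes "c \<in> \<C>_hat R" "(a, b, d) \<in> corners c"
  shows "allowed a b d"
proof -
  obtain f where "c = Int_curve f"
    using assms(1) by (auto simp: \<C>_hat_def)
  then show ?thesis
    using assms Int_curve_in_\<C>_hat by auto
qed

text \<open>Each segment can be continued at its end by \<open>R_joint_exists\<close>; dependent
  choice iterates this on pairs of consecutive vertices.\<close>

lemma half_curve:
  assumes "adj p q"
  shows "\<exists>F :: nat \<Rightarrow> point. F 0 = p \<and> F 1 = q \<and> (\<forall>n. allowed (F n) (F (n + 1)) (F (n + 2)))"
proof -
  \<comment> \<open>The clause for \<open>n = 0\<close> fixes the initial pair, which the choice
    principle would otherwise leave open.\<close>
  define P where "P n s \<longleftrightarrow> adj (fst s) (snd s) \<and> (n = 0 \<longrightarrow> s = (p, q))" for n :: nat and s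
  define Q where "Q s s' \<longleftrightarrow> fst s' = snd s \<and> allowed (fst s) (snd s) (snd s')" for s s'
  have "\<exists>s'. P (Suc n) s' \<and> Q s s'" if "P n s" for n s
  proof -
    have "fst s - snd s \<in> E"
      using that adj_sym by (auto simp: P_def adj_def)
    then obtain v where "R_joint R (snd s) (fst s - snd s) v"
      using R_joint_exists by blast
    then have "allowed (fst s) (snd s) (snd s + v)"
      by (simp add: allowed_def)
    moreover from this have "adj (snd s) (snd s + v)"
      using allowed_D by blast
    ultimately show ?thesis
      by (intro exI[of _ "(snd s, snd s + v)"]) (auto simp: P_def Q_def)
  qed
  moreover have "\<exists>s. P 0 s"
    using assms by (auto simp: P_def)
  ultimately obtain g where g: "\<And>n. P n (g n)" "\<And>n. Q (g n) (g (Suc n))"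
    using dependent_nat_choice[of P "\<lambda>_. Q"] by blast
  have "g 0 = (p, q)"
    using g(1)[of 0] by (simp add: P_def)
  then show ?thesis
    using g(2) by (intro exI[of _ "\<lambda>n. fst (g n)"]) (auto simp: Q_def)
qed

lemma \<C>_hat_through:
  assumes "allowed a y b"
  obtains c where "c \<in> \<C>_hat R" "(a, y, b) \<in> corners c"
proof -
  have adj: "adj y a" "adj y b"
    using allowed_D[OF assms] adj_sym by auto
  obtain F :: "nat \<Rightarrow> point" where F: "F 0 = y" "F 1 = b" "\<And>n. allowed (F n) (F (n + 1)) (F (n + 2))"
    using half_curve[OF adj(2)] by blast
  obtain G :: "nat \<Rightarrow> point" where G: "G 0 = y" "G 1 = a" "\<And>n. allowed (G n) (G (n + 1)) (G (n + 2))"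
    using half_curve[OF adj(1)] by blast
  \<comment> \<open>\<open>G\<close> is traversed backwards, so that the vertices at indices -1, 0
    and 1 are \<open>a\<close>, \<open>y\<close> and \<open>b\<close>.\<close>
  define f where "f k = (if k \<ge> 0 then F (nat k) else G (nat (- k)))" for k :: int
  have f_neg: "f (- int n) = G n" for n
    using F(1) G(1) by (cases n) (auto simp: f_def nat_add_distrib)
  have f_pos: "f (int n) = F n" for n
    by (simp add: f_def)
  have "allowed (f k) (f (k + 1)) (f (k + 2))" for k
  proof -
    \<comment> \<open>The corner with middle index \<open>k + 1\<close> lies on \<open>F\<close>, at
      \<open>y\<close>, or on \<open>G\<close>; the last case uses the symmetry of
      \<open>allowed\<close>.\<close>
    consider n where "k = int n" | "k = - 1" | n where "k = - int (n + 2)"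
    proof -
      consider "0 \<le> k" | "k = - 1" | "k \<le> - 2" by linarith
      then show thesis
        using that(1)[of "nat k"] that(2) that(3)[of "nat (- k - 2)"] by cases auto
    qed
    then show ?thesis
    proof cases
      case (1 n)
      then show ?thesis
        using F(3)[of n] f_pos[of n] f_pos[of "n + 1"] f_pos[of "n + 2"] by (simp add: add.commute)
    next
      case 2
      then show ?thesis
        using assms f_neg[of 1] f_pos[of 0] f_pos[of 1] F(1,2) G(2) by simp
    next
      case (3 n)
      have "k + 1 = - int (n + 1)" "k + 2 = - int n"
        using 3 by auto
      then show ?thesis
        using allowed_D[OF G(3)[of n]] f_neg 3 by metis
    qed
  qed
  then have "Int_curve f \<in> \<C>_hat R"
    using Int_curve_in_\<C>_hat by blast
  moreover have "(a, y, b) \<in> corners (Int_curve f)"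
    using f_neg[of 1] f_pos[of 0] f_pos[of 1] F(1,2) G(2) by (auto intro!: exI[of _ "- 1"])
  ultimately show ?thesis
    using that by blast
qed

lemma segments_of_\<C>_hat: "segments_of (\<C>_hat R) = segments"
proof (intro set_eqI iffI)
  fix s assume "s \<in> segments_of (\<C>_hat R)"
  then show "s \<in> segments"
    by (auto simp: segments_of_def \<C>_hat_def is_curve_def simp del: steps.simps corners.simps)
next
  fix s assume "s \<in> segments"
  then obtain a b where ab: "s = {a, b}" "adj a b"
    using segmentE by blast
  obtain F :: "nat \<Rightarrow> point" where F: "F 0 = a" "F 1 = b" "\<And>n. allowed (F n) (F (n + 1)) (F (n + 2))"
    using half_curve[OF ab(2)] by blast
  then have "allowed a b (F 2)"
    using F(3)[of 0] F(1,2) by (simp add: numeral_2_eq_2)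
  then obtain c where c: "c \<in> \<C>_hat R" "(a, b, F 2) \<in> corners c"
    using \<C>_hat_through by blast
  then have "(a, b) \<in> steps c"
    by (cases c) fastforce+
  then show "s \<in> segments_of (\<C>_hat R)"
    using ab(1) c(1) by (auto simp: segments_of_def)
qed

lemma connected_\<C>_hat:
  assumes "u \<in> E" "v \<in> E"
  shows "connected (\<C>_hat R) {y, y + u} {y, y + v} \<longleftrightarrow> R_joint R y u v"
proof -
  have "connected (\<C>_hat R) {y, y + u} {y, y + v} \<longleftrightarrow>
    (\<exists>c \<in> \<C>_hat R. (y + u, y, y + v) \<in> corners c \<or> (y + v, y, y + u) \<in> corners c)"
  proof (rule connected_iff)
    show "adj a b \<and> adj b d \<and> a \<noteq> d" if "c \<in> \<C>_hat R" "(a, b, d) \<in> corners c" for c a b d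
      using \<C>_hat_corner[OF that] allowed_D by blast
  qed (use assms in simp_all)
  also have "\<dots> \<longleftrightarrow> allowed (y + u) y (y + v)"
    using \<C>_hat_corner allowed_D \<C>_hat_through by metis
  finally show ?thesis
    by (simp add: allowed_def)
qed

lemma connected_\<C>_hatE:
  assumes "connected (\<C>_hat R) s t"
  obtains y u v where "s = {y, y + u}" "t = {y, y + v}" "R_joint R y u v"
proof -
  obtain c a b d where c: "c \<in> \<C>_hat R" "(a, b, d) \<in> corners c"
    "s = {a, b} \<and> t = {b, d} \<or> s = {b, d} \<and> t = {a, b}"
    using assms by (auto simp: connected_def)
  have "allowed a b d" "allowed d b a"
    using \<C>_hat_corner[OF c(1,2)] allowed_D by blast+
  then have "s = {b, b + (a - b)} \<and> t = {b, b + (d - b)} \<and> R_joint R b (a - b) (d - b) \<or>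
    s = {b, b + (d - b)} \<and> t = {b, b + (a - b)} \<and> R_joint R b (d - b) (a - b)"
    using c(3) by (auto simp: allowed_def)
  then show ?thesis
    using that by blast
qed

section \<open>Restrictions to boxes\<close>

definition in_box :: "point \<Rightarrow> nat \<Rightarrow> point \<Rightarrow> bool" where
  "in_box x h p \<longleftrightarrow> (\<forall>i. \<bar>p $ i - x $ i\<bar> \<le> int h)"

text \<open>A box is an intersection of half-spaces, hence convex, so containing the endpoints is
  enough.\<close>

lemma interval_of_subset_box: "interval_of s \<subseteq> box x h \<longleftrightarrow> (\<forall>p \<in> s. in_box x h p)"
proof -
  have "box x h = (\<Inter>i. {y. y $ i \<le> real_of_int (x $ i) + real h} \<inter> {y. real_of_int (x $ i) - real h \<le> y $ i})"
    by (auto simp: box_def abs_le_iff algebra_simps)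
  moreover have "convex {y :: real ^ 3. y $ i \<le> c}" "convex {y :: real ^ 3. c \<le> y $ i}" for i c
    using convex_halfspace_le[of "axis i 1 :: real ^ 3" c] convex_halfspace_ge[of c "axis i 1 :: real ^ 3"]
    by (simp_all add: inner_axis' )
  ultimately have "convex (box x h)"
    by (auto intro!: convex_INT convex_Int)
  then have "interval_of s \<subseteq> box x h \<longleftrightarrow> real_point ` s \<subseteq> box x h"
    unfolding interval_of_def by (metis hull_minimal hull_subset order_trans)
  moreover have "real_point p \<in> box x h \<longleftrightarrow> in_box x h p" for p
  proof -
    have "\<bar>real_of_int (p $ i) - real_of_int (x $ i)\<bar> \<le> real h \<longleftrightarrow> \<bar>p $ i - x $ i\<bar> \<le> int h" for i
      by linarith
    then show ?thesis
      by (simp add: box_def real_point_def in_box_def)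
  qed
  ultimately show ?thesis
    by auto
qed

definition box_segments :: "point \<Rightarrow> nat \<Rightarrow> seg set" where
  "box_segments x h = {s \<in> segments. \<forall>p \<in> s. in_box x h p}"

lemma restriction_eq:
  "restriction (\<C>_hat R) (box x h) = (box_segments x h,
    {(s, t). s \<in> box_segments x h \<and> t \<in> box_segments x h \<and> connected (\<C>_hat R) s t})"
  by (simp add: restriction_def segments_of_\<C>_hat interval_of_subset_box box_segments_def Let_def)

lemma in_box_shift: "in_box (x + w) h (w + p) \<longleftrightarrow> in_box x h p"
  by (simp add: in_box_def)

lemma box_segments_shift: "box_segments (x + w) h = (`) ((+) w) ` box_segments x h"
proof -
  have 1: "(+) w ` s \<in> box_segments (x + w) h" if "s \<in> box_segments x h" for s x w
  proof -
    have "s \<in> segments"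
      using that by (simp add: box_segments_def)
    then obtain a b where "s = {a, b}" "adj a b"
      using segmentE by blast
    then show ?thesis
      using that by (auto simp: box_segments_def segments_iff in_box_shift adj_def)
  qed
  have "s \<in> (`) ((+) w) ` box_segments x h" if "s \<in> box_segments (x + w) h" for s
    using 1[OF that, of "- w"] by (auto simp: image_iff image_image intro!: bexI[of _ "(+) (- w) ` s"])
  then show ?thesis
    using 1 by auto
qed

text \<open>All segments are present in any case, and a connexion between segments of the box takes
  place at a point of the box; only the relations at these points have to agree.\<close>

lemma restriction_shift:
  assumes "\<And>b u v. in_box x h b \<Longrightarrow> u \<in> E \<Longrightarrow> v \<in> E \<Longrightarrow> R_joint R (w + b) u v \<longleftrightarrow> R_joint R b u v"
  shows "restriction (\<C>_hat R) (box (x + w) h) = translate w (restriction (\<C>_hat R) (box x h))"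
proof -
  have "connected (\<C>_hat R) ((+) w ` s) ((+) w ` t) \<longleftrightarrow> connected (\<C>_hat R) s t" 
    if st: "s \<in> box_segments x h" for s t
  proof
    assume "connected (\<C>_hat R) s t"
    then obtain y u v where y: "s = {y, y + u}" "t = {y, y + v}" "R_joint R y u v"
      using connected_\<C>_hatE by blast
    then have "R_joint R (w + y) u v"
      using assms st R_joint_D[OF y(3)] by (auto simp: box_segments_def)
    then show "connected (\<C>_hat R) ((+) w ` s) ((+) w ` t)"
      using connected_\<C>_hat[of u v "w + y"] R_joint_D[OF y(3)] y(1,2) by (simp add: add.assoc)
  next
    assume "connected (\<C>_hat R) ((+) w ` s) ((+) w ` t)"
    then obtain y u v where y: "(+) w ` s = {y, y + u}" "(+) w ` t = {y, y + v}" "R_joint R y u v"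
      using connected_\<C>_hatE by blast
    have inv: "r = (+) (- w) ` (+) w ` r" for r
      by (simp add: image_image)
    have s: "s = {y - w, y - w + u}" and t: "t = {y - w, y - w + v}"
      using inv[of s] inv[of t] y(1,2) by (simp_all add: algebra_simps)
    have "R_joint R (y - w) u v"
      using assms[of "y - w" u v] st y(3) R_joint_D[OF y(3)] s by (auto simp: box_segments_def)
    then show "connected (\<C>_hat R) s t"
      unfolding s t using connected_\<C>_hat R_joint_D[OF y(3)] by blast
  qed
  then show ?thesis
    unfolding restriction_eq translate_def box_segments_shift by (auto simp: image_iff)
qed

text \<open>The segments of a restriction determine its box, which forces the translation. The
  relations are compared only within distance \<open>h - 1\<close>, where all six segments at a
  point lie in the box.\<close>

lemma restriction_shiftD:
  assumes eq: "restriction (\<C>_hat R) (box z h) = translate w (restriction (\<C>_hat R) (box x h))" and "h \<ge> 1"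
  shows "z = x + w"
    and "in_box x (h - 1) b \<Longrightarrow> u \<in> E \<Longrightarrow> v \<in> E \<Longrightarrow> R_joint R (w + b) u v \<longleftrightarrow> R_joint R b u v"
proof -
  have seg: "box_segments z h = (`) ((+) w) ` box_segments x h"
    using eq by (simp add: restriction_eq translate_def)
  have vertex: "in_box y h p \<longleftrightarrow> (\<exists>s \<in> box_segments y h. p \<in> s)" for y p
  proof
    assume p: "in_box y h p"
    \<comment> \<open>A neighbour in the direction of the centre, so that it stays in the
      box.\<close>
    define q where "q = p + (if p $ 1 \<ge> y $ 1 then - axis 1 1 else axis 1 1)"
    have "adj p q"
      by (auto simp: q_def adj_def E_def)
    moreover have "\<bar>q $ i - y $ i\<bar> \<le> int h" for i
    proof -
      have "\<bar>p $ i - y $ i\<bar> \<le> int h"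
        using p by (simp add: in_box_def)
      then show ?thesis
        using \<open>h \<ge> 1\<close> by (auto simp: q_def axis_def)
    qed
    then have "in_box y h q"
      by (simp add: in_box_def)
    ultimately have "{p, q} \<in> box_segments y h"
      using p by (simp add: box_segments_def segments_iff)
    then show "\<exists>s \<in> box_segments y h. p \<in> s" by blast
  qed (auto simp: box_segments_def)
  have box: "in_box z h (w + p) \<longleftrightarrow> in_box x h p" for p
    unfolding vertex seg by auto
  \<comment> \<open>Two opposite corners of the translated box pin down its centre.\<close>
  have "in_box z h (w + (x + (\<chi> i. int h)))" "in_box z h (w + (x - (\<chi> i. int h)))"
    unfolding box by (simp_all add: in_box_def)
  then have "\<bar>w $ i + (x $ i + int h) - z $ i\<bar> \<le> int h" "\<bar>w $ i + (x $ i - int h) - z $ i\<bar> \<le> int h" for i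
    by (simp_all add: in_box_def)
  then have "z $ i = x $ i + w $ i" for i
    by (smt (verit, best))
  then show z: "z = x + w"
    by (simp add: vec_eq_iff)
  assume b: "in_box x (h - 1) b" and uv: "u \<in> E" "v \<in> E"
  have e: "\<bar>e $ i\<bar> \<le> 1" if "e \<in> E" for e i
    using that by (auto simp: E_def axis_def)
  have b': "\<bar>b $ i - x $ i\<bar> \<le> int h - 1" for i
    using b \<open>h \<ge> 1\<close> by (simp add: in_box_def of_nat_diff)
  have "\<bar>(b + e) $ i - x $ i\<bar> \<le> int h" if "e \<in> E" for e i
    using e[OF that, of i] b'[of i] unfolding vector_add_component by linarith
  then have "in_box x h (b + e)" if "e \<in> E" for e
    using that by (simp add: in_box_def)
  moreover have "in_box x h b"
    using b'[THEN order_trans] by (simp add: in_box_def)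
  ultimately have S: "{b, b + u} \<in> box_segments x h" "{b, b + v} \<in> box_segments x h"
    using uv by (auto simp: box_segments_def segments_iff)
  have "connected (\<C>_hat R) ((+) w ` s) ((+) w ` t) \<longleftrightarrow> connected (\<C>_hat R) s t"
    if "s \<in> box_segments x h" "t \<in> box_segments x h" for s t
  proof -
    define T where "T = (`) ((+) w)"
    define conns where "conns y = {(s, t). s \<in> box_segments y h \<and> t \<in> box_segments y h \<and> connected (\<C>_hat R) s t}" for y
    have "inj T"
      by (simp add: T_def inj_image_eq_iff inj_def)
    have "conns z = map_prod T T ` conns x"
      using arg_cong[OF eq, of snd] by (simp add: restriction_eq translate_def conns_def T_def)
    then have "(T s, T t) \<in> conns z \<longleftrightarrow> (s, t) \<in> conns x"
      using inj_image_mem_iff[OF prod.inj_map[OF \<open>inj T\<close> \<open>inj T\<close>], of "(s, t)" "conns x"] by simp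
    moreover have "T s \<in> box_segments z h" "T t \<in> box_segments z h"
      using that unfolding seg T_def by blast+
    ultimately show ?thesis
      using that by (simp add: conns_def T_def)
  qed
  from this[OF S] show "R_joint R (w + b) u v \<longleftrightarrow> R_joint R b u v"
    using connected_\<C>_hat[OF uv, of b] connected_\<C>_hat[OF uv, of "w + b"] by (simp add: add.assoc)
qed

end

section \<open>The equivalence\<close>

text \<open>Turns depend on classes modulo 4 only, so the finite check covers every
  \<open>z\<close>. By uniqueness, a connexion of \<open>u\<close> to some
  \<open>w \<noteq> v\<close> at \<open>z + b\<close> rules out \<open>v\<close>; both points are
  nonzero, out of reach of \<open>R\<close>.\<close>

lemma shift_detected_joint:
  assumes "\<not> evn z"
  obtains b u v where "\<forall>i. \<bar>b $ i\<bar> \<le> 1" "b \<noteq> 0" "z + b \<noteq> 0" "joint b u v" "\<not> joint (z + b) u v"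
proof -
  have "shift_detected (mod4 (coords z))"
    using shift_detected mod4_in_cube by (simp add: list_all_iff)
  then obtain t where t: "t \<in> {((-1,-1,-1), (-1,0,0), (0,0,1)), ((-1,0,0), (0,0,1), (-1,0,0)), ((0,1,-1), (-1,0,0), (0,0,1))}"
    "case t of (b, u, v) \<Rightarrow> turning (mod4 b) u v
      \<and> (\<exists>w\<in>set dirs. w \<noteq> v \<and> turning (mod4 (add3 b (mod4 (coords z)))) u w)"
    using assms unfolding shift_detected_def even3_mod4 even3_coords by blast
  obtain b u v where buv: "t = (b, u, v)"
    by (cases t)
  then obtain w where *: "b \<in> {(-1,-1,-1), (-1,0,0), (0,1,-1)}" "turning (mod4 b) u v" "w \<noteq> v"
    "turning (mod4 (add3 b (mod4 (coords z)))) u w"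
    using t by auto
  have "mod4 (add3 s (mod4 t)) = mod4 (add3 s t)" for s t
    by (cases s; cases t) (simp add: mod_simps)
  moreover have "add3 b (coords z) = coords (z + pt b)"
    using pt_add3[of b "coords z"] by (metis add.commute coords_pt pt_coords)
  ultimately have t: "turning (mod4 (coords (z + pt b))) u w"
    using *(4) by simp
  have odd: "\<not> evn (pt b)" "\<not> evn (z + pt b)"
    using turning_not_even[OF *(2)] turning_not_even[OF t] even3_coords[of "pt b"] even3_coords by auto
  have "joint (pt b) (pt u) (pt v)" "\<not> joint (z + pt b) (pt u) (pt v)"
    using *(2,3) t turning_unique[OF t, of v] by (auto simp: joint_odd odd)
  moreover have "\<bar>pt b $ i\<bar> \<le> 1" for i
    using *(1) exhaust_3[of i] by auto
  moreover have "evn 0"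
    by (simp add: evn_def)
  then have "pt b \<noteq> 0" "z + pt b \<noteq> 0"
    using odd \<open>evn 0\<close> by metis+
  ultimately show ?thesis
    using that by blast
qed

section \<open>Powers of two and property (P)\<close>

lemma scaled_odd_neq_0:
  assumes "\<not> evn y"
  shows "2 ^ k *s (4 *s m + y) \<noteq> 0"
proof -
  obtain i where "odd (y $ i)"
    using assms by (auto simp: evn_def)
  then have "odd ((4 *s m + y) $ i)"
    by simp
  then have "(4 *s m + y) $ i \<noteq> 0"
    by (metis dvd_0_right)
  then have "(2 ^ k *s (4 *s m + y)) $ i \<noteq> 0"
    unfolding vector_smult_component[of "2 ^ k"] by (metis mult_eq_0_iff power_not_zero zero_neq_numeral)
  then show ?thesis
    by (metis zero_index)
qed

text \<open>Each of the doublings from \<open>2c\<close> to \<open>4c\<close> and from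
  \<open>4c\<close> to \<open>8c\<close> applies \<theta>, and \<theta> is an involution.\<close>

lemma joint_8: "joint (8 *s c) = joint (2 *s c)"
proof (intro ext)
  fix u v
  show "joint (8 *s c) u v \<longleftrightarrow> joint (2 *s c) u v"
  proof (cases "u \<in> E \<and> v \<in> E")
    case True
    then have "joint (4 *s (2 *s c)) u v \<longleftrightarrow> joint (2 *s (2 *s c)) (\<theta> u) (\<theta> v)"
      using joint_\<theta>[of "\<theta> u" "\<theta> v" "2 *s c"] by simp
    also have "\<dots> \<longleftrightarrow> joint (2 *s c) u v"
      using joint_\<theta>[of u v c] True by simp
    finally show ?thesis by simp
  next
    case False
    then show ?thesis using joint_E by blast
  qed
qed

lemma joint_pow: "joint (2 ^ (2 * j + Suc k) *s c) = joint (2 ^ Suc k *s c)"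
proof (induction j)
  case (Suc j)
  have "joint (2 ^ (2 * Suc j + Suc k) *s c) = joint (8 *s (2 ^ (2 * j + k) *s c))"
    by (simp add: power_add mult_ac)
  also have "\<dots> = joint (2 ^ (2 * j + Suc k) *s c)"
    unfolding joint_8 by simp
  finally show ?case
    using Suc.IH by simp
qed simp

lemma joint_4:
  assumes "pairing_relation E R"
  shows "joint (4 *s c) = R \<longleftrightarrow> joint (2 *s c) = (\<lambda>u v. R (\<theta> u) (\<theta> v))"
proof -
  have R: "R u v \<Longrightarrow> u \<in> E \<and> v \<in> E" for u v
    using pairing_relationD(1)[OF assms] by blast
  have eq: "joint (2 *s c) u v \<longleftrightarrow> joint (4 *s c) (\<theta> u) (\<theta> v)" for u v
  proof (cases "u \<in> E \<and> v \<in> E")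
    case True
    then show ?thesis using joint_\<theta> by simp
  next
    case False
    then show ?thesis using joint_E by (metis \<theta>_E)
  qed
  show ?thesis
    unfolding fun_eq_iff eq by (metis \<theta>_invol)
qed

text \<open>Up to multiples of 4, \<open>y\<close> has coordinates in -1, 0, 1, 2, so
  \<open>2y\<close> ranges over the cube in (P), and excluding the coordinates 0 and 4 says that
  \<open>y\<close> is not even. The alternative with \<theta> accounts for
  \<open>4y\<close>.\<close>

lemma property_P_iff:
  assumes "pairing_relation E R"
  shows "property_P R \<longleftrightarrow> (\<exists>y. \<not> evn y \<and> (joint (2 *s y) = R \<or> joint (4 *s y) = R))"
proof
  assume "property_P R"
  then obtain x where x: "\<forall>i. x $ i \<in> {-2, 0, 2, 4}" "\<not> (\<forall>i. x $ i \<in> {0, 4})"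
    "joint x = R \<or> joint x = (\<lambda>u v. R (\<theta> u) (\<theta> v))"
    by (auto simp: property_P_def R_at_eq)
  have "even (x $ i)" for i
    using x(1)[THEN spec, of i] by auto
  then obtain y where y: "x = 2 *s y"
    using evn_iff evn_def by blast
  obtain i where "x $ i \<notin> {0, 4}"
    using x(2) by blast
  then have "y $ i = -1 \<or> y $ i = 1"
    using x(1)[THEN spec, of i] y by auto
  then have "\<not> evn y"
    by (auto simp: evn_def intro!: exI[of _ i])
  then show "\<exists>y. \<not> evn y \<and> (joint (2 *s y) = R \<or> joint (4 *s y) = R)"
    using x(3) unfolding y joint_4[OF assms] by blast
next
  assume "\<exists>y. \<not> evn y \<and> (joint (2 *s y) = R \<or> joint (4 *s y) = R)"
  then obtain y where y: "\<not> evn y" "joint (2 *s y) = R \<or> joint (4 *s y) = R"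
    by blast
  \<comment> \<open>Shifting by 1 before and after reduction yields representatives in -1, 0, 1,
    2.\<close>
  define z :: point where "z = (\<chi> i. (y $ i + 1) mod 4 - 1)"
  define m :: point where "m = (\<chi> i. (y $ i + 1) div 4)"
  have "y $ i = (4 *s m + z) $ i" for i
    using mult_div_mod_eq[of 4 "y $ i + 1"]
    unfolding m_def z_def vector_add_component vector_smult_component vec_lambda_beta by linarith
  then have yz: "y = 4 *s m + z"
    unfolding vec_eq_iff by blast
  then have odd: "\<not> evn z"
    using y(1) by (simp add: evn_def)
  have "joint (2 ^ k *s y) = joint (2 ^ k *s z)" for k
    unfolding yz using joint_periodic[OF odd] by blast
  from this[of 1] this[of 2] have "joint (2 *s z) = R \<or> joint (2 *s z) = (\<lambda>u v. R (\<theta> u) (\<theta> v))"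
    using y(2) by (simp add: joint_4[OF assms, symmetric])
  moreover have z: "z $ i \<in> {-1, 0, 1, 2}" for i
  proof -
    have "(y $ i + 1) mod 4 \<in> {0, 1, 2, 3}" by auto
    then show ?thesis unfolding z_def by auto
  qed
  then have "\<forall>i. (2 *s z) $ i \<in> {-2, 0, 2, 4}"
    by force
  moreover have "\<not> (\<forall>i. (2 *s z) $ i \<in> {0, 4})"
  proof
    assume *: "\<forall>i. (2 *s z) $ i \<in> {0, 4}"
    have "even (z $ i)" for i
      using *[THEN spec, of i] by auto
    then show False using odd by (simp add: evn_def)
  qed
  ultimately show "property_P R"
    unfolding property_P_def R_at_eq by blast
qed

context pairing
begin

lemma local_isomorphism_imp_property_P:
  assumes "local_isomorphism_property (\<C>_hat R)"
  shows "property_P R"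
proof -
  \<comment> \<open>Radius 2 makes the relations comparable at all points within distance 1 of 0,
    where the detecting turns lie.\<close>
  obtain t where t: "t > 0"
    "\<And>q :: real ^ 3. \<exists>z. real_point z \<in> cball q t
        \<and> (\<exists>w. restriction (\<C>_hat R) (box z 2) = translate w (restriction (\<C>_hat R) (box 0 2)))"
    using assms unfolding local_isomorphism_property_def by (metis one_le_numeral)
  \<comment> \<open>This ball misses the origin, which keeps the copy from being the original
    one.\<close>
  obtain z w where z: "real_point z \<in> cball (\<chi> i. t + 1) t"
    "restriction (\<C>_hat R) (box z 2) = translate w (restriction (\<C>_hat R) (box 0 2))"
    using t(2) by blast
  have w: "w = z"
    using restriction_shiftD(1)[OF z(2)] by simp
  have eq: "R_joint R (z + b) u v \<longleftrightarrow> R_joint R b u v" if "\<And>i. \<bar>b $ i\<bar> \<le> 1" "u \<in> E" "v \<in> E" for b u v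
    using restriction_shiftD(2)[OF z(2), of b u v] that by (simp add: in_box_def w)
  have "z \<noteq> 0"
  proof
    assume "z = 0"
    then have "norm ((\<chi> i. t + 1) :: real ^ 3) \<le> t"
      using z(1) by (simp add: real_point_def dist_norm zero_vec_def[symmetric])
    then show False
      using component_le_norm_cart[of "(\<chi> i. t + 1) :: real ^ 3" 1] t(1) by simp
  qed
  have "evn z"
  proof (rule ccontr)
    assume "\<not> evn z"
    then obtain b u v where "\<forall>i. \<bar>b $ i\<bar> \<le> 1" "b \<noteq> 0" "z + b \<noteq> 0" "joint b u v" "\<not> joint (z + b) u v"
      using shift_detected_joint by blast
    then show False
      using eq[of b u v] joint_E[of b u v] by (simp add: R_joint_def)
  qed
  have R: "joint z = R"
  proof (intro ext)
    fix u v
    show "joint z u v \<longleftrightarrow> R u v"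
    proof (cases "u \<in> E \<and> v \<in> E")
      case True
      then show ?thesis
        using eq[of 0 u v] \<open>z \<noteq> 0\<close> by (simp add: R_joint_def)
    next
      case False
      then show ?thesis
        using joint_E pairing_relationD(1)[OF pairing] by blast
    qed
  qed
  obtain k y where y: "z = 2 ^ k *s y" "\<not> evn y"
    using odd_part[OF \<open>z \<noteq> 0\<close>] .
  have "k \<noteq> 0"
    using y \<open>evn z\<close> by (cases k) auto
  then have "\<exists>j. k = 2 * j + Suc 0 \<or> k = 2 * j + Suc 1"
    by presburger
  then obtain j where "k = 2 * j + Suc 0 \<or> k = 2 * j + Suc 1"
    by blast
  then have "joint (2 *s y) = R \<or> joint (4 *s y) = R"
    using R joint_pow[of j 0 y] joint_pow[of j 1 y] by (auto simp: y(1))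
  then show ?thesis
    unfolding property_P_iff[OF pairing] using y(2) by blast
qed

text \<open>At \<open>b = 0\<close> the shifted point carries \<open>R\<close>. Otherwise the bound
  on \<open>b\<close> limits the power of two in it, and the shift is a period of the connexions at
  that scale.\<close>

lemma R_joint_shift:
  assumes y: "\<not> evn y" "joint (2 ^ Suc k *s y) = R" and b: "\<And>i. \<bar>b $ i\<bar> < 2 ^ k"
  shows "R_joint R (2 ^ Suc k *s (4 *s m + y) + b) = R_joint R b"
proof (cases "b = 0")
  case True
  have "2 ^ Suc k *s (4 *s m + y) \<noteq> 0"
    using scaled_odd_neq_0[OF y(1)] .
  then show ?thesis
    using True y joint_periodic[OF y(1), of "Suc k"] by (auto simp: R_joint_def fun_eq_iff simp del: power_Suc)
next
  case False
  then obtain j w where w: "b = 2 ^ j *s w" "\<not> evn w"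
    using odd_part by blast
  then obtain i where "odd (w $ i)"
    by (auto simp: evn_def)
  then have "1 \<le> \<bar>w $ i\<bar>"
    by (cases "w $ i = 0") auto
  then have "2 ^ j \<le> \<bar>b $ i\<bar>"
    by (simp add: w(1) abs_mult)
  then have "(2 :: int) ^ j < 2 ^ k"
    using b[of i] by linarith
  \<comment> \<open>From \<open>j < k\<close>: the shift is a multiple of \<open>2 ^ j * 4\<close>,
    as \<open>joint_periodic\<close> requires.\<close>
  then obtain d where d: "Suc k = j + 2 + d"
    using power_strict_increasing_iff[of "2 :: int" j k] less_imp_Suc_add[of j k] by auto
  define n where "n = 2 ^ d *s (4 *s m + y)"
  have eq: "2 ^ Suc k *s (4 *s m + y) + b = 2 ^ j *s (4 *s n + w)"
    unfolding d n_def w(1) by (simp add: vec_eq_iff power_add algebra_simps)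
  have "2 ^ j *s (4 *s n + w) \<noteq> 0"
    using scaled_odd_neq_0[OF w(2)] .
  then show ?thesis
    using False joint_periodic[OF w(2), of j n] unfolding eq by (simp add: R_joint_def w(1) fun_eq_iff)
qed

lemma property_P_imp_local_isomorphism:
  assumes "property_P R"
  shows "local_isomorphism_property (\<C>_hat R)"
  unfolding local_isomorphism_property_def
proof (intro allI impI)
  fix x :: point and h :: nat
  assume "1 \<le> h"
  obtain y where y: "\<not> evn y" "joint (2 *s y) = R \<or> joint (4 *s y) = R"
    using assms unfolding property_P_iff[OF pairing] by blast
  define H where "H = h + nat (\<Sum>i\<in>UNIV. \<bar>x $ i\<bar>)"
  \<comment> \<open>Only the parity of the exponent matters, so it can be taken large enough for
    \<open>2 ^ k\<close> to exceed all coordinates in the box.\<close>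
  obtain k where k: "H \<le> k" "joint (2 ^ Suc k *s y) = R"
  proof -
    have "joint (2 ^ Suc (2 * H) *s y) = joint (2 *s y)" "joint (2 ^ Suc (2 * H + 1) *s y) = joint (4 *s y)"
      using joint_pow[of H 0 y] joint_pow[of H 1 y] by simp_all
    then show thesis
      using y(2) that[of "2 * H"] that[of "2 * H + 1"] by auto
  qed
  have small: "\<bar>b $ i\<bar> < 2 ^ k" if "in_box x h b" for b i
  proof -
    have "\<bar>x $ i\<bar> \<le> (\<Sum>i\<in>UNIV. \<bar>x $ i\<bar>)"
      by (rule member_le_sum) auto
    moreover have "\<bar>b $ i - x $ i\<bar> \<le> int h"
      using that by (simp add: in_box_def)
    ultimately have "\<bar>b $ i\<bar> \<le> int H"
      unfolding H_def by linarith
    also have "\<dots> < int (2 ^ k)"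
      using k(1) less_exp[of k] by linarith
    finally show ?thesis by simp
  qed
  \<comment> \<open>The spacing of the admissible shifts, \<open>2 ^ Suc k * 4\<close>.\<close>
  define c :: real where "c = 2 ^ (k + 3)"
  have c: "c > 0" by (simp add: c_def)
  show "\<exists>t>0. \<forall>q. \<exists>z. real_point z \<in> cball q t \<and>
    (\<exists>w. restriction (\<C>_hat R) (box z h) = translate w (restriction (\<C>_hat R) (box x h)))"
  proof (intro exI[of _ "3 * c"] conjI allI)
    show "3 * c > 0" using c by simp
    fix q :: "real ^ 3"
    define e where "e i = real_of_int (x $ i) + 2 ^ Suc k * real_of_int (y $ i)" for i
    \<comment> \<open>Rounding down puts \<open>x + w\<close> within \<open>c\<close> of
      \<open>q\<close> in each coordinate, hence within \<open>3 * c\<close> in norm.\<close>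
    define m :: point where "m = (\<chi> i. \<lfloor>(q $ i - e i) / c\<rfloor>)"
    define w where "w = 2 ^ Suc k *s (4 *s m + y)"
    have "\<bar>(q - real_point (x + w)) $ i\<bar> \<le> c" for i
    proof -
      define a where "a = (q $ i - e i) / c"
      have "(q - real_point (x + w)) $ i = q $ i - e i - c * of_int \<lfloor>a\<rfloor>"
        by (simp add: real_point_def w_def m_def a_def e_def c_def power_add algebra_simps)
      also have "\<dots> = c * (a - of_int \<lfloor>a\<rfloor>)"
        using c by (simp add: a_def field_simps)
      finally have *: "(q - real_point (x + w)) $ i = c * (a - of_int \<lfloor>a\<rfloor>)" .
      have "0 \<le> a - of_int \<lfloor>a\<rfloor>" "a - of_int \<lfloor>a\<rfloor> \<le> 1"
        by linarith+
      then show ?thesis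
        unfolding * using c by (simp add: abs_mult mult_left_le)
    qed
    then have "(\<Sum>i\<in>UNIV. \<bar>(q - real_point (x + w)) $ i\<bar>) \<le> (\<Sum>i\<in>(UNIV :: 3 set). c)"
      by (intro sum_mono)
    then have "norm (q - real_point (x + w)) \<le> 3 * c"
      using norm_le_l1_cart[of "q - real_point (x + w)"] by simp
    then have "real_point (x + w) \<in> cball q (3 * c)"
      by (simp add: dist_norm)
    moreover have "restriction (\<C>_hat R) (box (x + w) h) = translate w (restriction (\<C>_hat R) (box x h))"
      using R_joint_shift[OF y(1) k(2) small, of _ m] by (intro restriction_shift) (simp add: w_def)
    ultimately show "\<exists>z. real_point z \<in> cball q (3 * c) \<and>
      (\<exists>w. restriction (\<C>_hat R) (box z h) = translate w (restriction (\<C>_hat R) (box x h)))"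
      by blast
  qed
qed

end

theorem theorem2p7:
  fixes R :: "point \<Rightarrow> point \<Rightarrow> bool"
  assumes "pairing_relation E R"
  shows "local_isomorphism_property (\<C>_hat R) \<longleftrightarrow> property_P R"
proof -
  interpret pairing R
    using assms by unfold_locales
  show ?thesis
    using local_isomorphism_imp_property_P property_P_imp_local_isomorphism by blast
qed

end
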